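(* Let $a>b>0$, $c^2=a^2-b^2$, and let $\mathcal{E}$ be the ellipse $x^2/a^2+y^2/b^2=1$. Let $\mathcal{E}_\triangle$ be the ellipse concentric and axis-aligned with $\mathcal{E}$ with semi-axes $a_\triangle=\frac{ac^2}{a^2+3b^2}$ (along $x$) and $b_\triangle=\frac{bc^2}{3a^2+b^2}$ (along $y$), and let $C=[x_c,y_c]$ lie on $\mathcal{E}_\triangle$. Let $\mathcal{T}_\triangle$ be the Poncelet family of triangles inscribed in $\mathcal{E}$ and circumscribing a circle centered at $C$. Then the locus $\mathcal{L}_{36}$ of $X_{36}$ over (the non-equilateral triangles of) $\mathcal{T}_\triangle$ is the line \[ b^2x_c\,x+a^2y_c\,y=\frac{b^2(a^4+2a^2b^2+5b^4)x_c^2+a^2(5a^4+2a^2b^2+b^4)y_c^2}{c^4}. \]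
   Context: For each point $C=[x_c,y_c]$ interior to $\mathcal{E}$ there is exactly one circle $\mathcal{K}$ centered at $C$, nested in $\mathcal{E}$, admitting triangles inscribed in $\mathcal{E}$ with all sides tangent to $\mathcal{K}$; its radius is $r=\big(b\sqrt{a^4-c^2x_c^2}-a\sqrt{b^4+c^2y_c^2}\big)/c^2$. By Poncelet's porism every point of $\mathcal{E}$ is then a vertex of exactly one such triangle; the Poncelet family about the circle centered at $C$ is the family of all these triangles, and $\mathcal{K}$ is their common incircle, with incenter $X_1=C$. $\mathcal{E}_\triangle$ is the locus of centroids of all equilateral triangles inscribed in $\mathcal{E}$; when $C\in\mathcal{E}_\triangle$ the family contains an equilateral triangle. $X_{36}$ is the inverse of the incenter $X_1$ with respect to the circumcircle (for an equilateral triangle it is at infinity). The locus of a triangle center is the set of its positions as the triangle ranges over the family. *)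

theory Defs
  imports "HOL-Analysis.Analysis"
begin

definition ellipse :: "real \<Rightarrow> real \<Rightarrow> (real \<times> real) set" where
  "ellipse a b = {(x, y). x\<^sup>2 / a\<^sup>2 + y\<^sup>2 / b\<^sup>2 = 1}"

definition ellipse_interior :: "real \<Rightarrow> real \<Rightarrow> (real \<times> real) set" where
  "ellipse_interior a b = {(x, y). x\<^sup>2 / a\<^sup>2 + y\<^sup>2 / b\<^sup>2 < 1}"

definition line_tangent :: "real \<times> real \<Rightarrow> real \<times> real \<Rightarrow> real \<times> real \<Rightarrow> real \<Rightarrow> bool" where
  "line_tangent P Q C r \<longleftrightarrow> (\<exists>!T. T \<in> affine hull {P, Q} \<and> T \<in> sphere C r)"

text \<open>Triangles are triples of labelled vertices.  The radius is not a parameter of the family: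
  for each \<open>C\<close> inside the ellipse only one \<open>r\<close> admits such triangles, so all members share the
  same circle.  As the circle lies inside the ellipse, a side line touches it within the chord,
  i.e. on the side itself, and the circle is the incircle rather than an excircle.\<close>

definition poncelet_family ::
    "real \<Rightarrow> real \<Rightarrow> real \<times> real \<Rightarrow> ((real \<times> real) \<times> (real \<times> real) \<times> (real \<times> real)) set" where
  "poncelet_family a b C =
     {(P, Q, R). \<not> collinear {P, Q, R} \<and>
        P \<in> ellipse a b \<and> Q \<in> ellipse a b \<and> R \<in> ellipse a b \<and>
        (\<exists>r>0. cball C r \<subseteq> ellipse_interior a b \<and>
           line_tangent P Q C r \<and> line_tangent Q R C r \<and> line_tangent R P C r)}"

definition equilateral :: "real \<times> real \<Rightarrow> real \<times> real \<Rightarrow> real \<times> real \<Rightarrow> bool" where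
  "equilateral P Q R \<longleftrightarrow> dist P Q = dist Q R \<and> dist Q R = dist R P"

text \<open>The incenter has barycentric coordinates equal to the lengths of the opposite sides.\<close>

definition incenter :: "real \<times> real \<Rightarrow> real \<times> real \<Rightarrow> real \<times> real \<Rightarrow> real \<times> real" where
  "incenter P Q R =
     (1 / (dist Q R + dist R P + dist P Q)) *\<^sub>R
       (dist Q R *\<^sub>R P + dist R P *\<^sub>R Q + dist P Q *\<^sub>R R)"

definition circumcenter :: "real \<times> real \<Rightarrow> real \<times> real \<Rightarrow> real \<times> real \<Rightarrow> real \<times> real" where
  "circumcenter P Q R = (THE Z. dist Z P = dist Z Q \<and> dist Z Q = dist Z R)"

definition circumradius :: "real \<times> real \<Rightarrow> real \<times> real \<Rightarrow> real \<times> real \<Rightarrow> real" where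
  "circumradius P Q R = dist (circumcenter P Q R) P"

text \<open>Inverse of \<open>X\<close> with respect to the circle with center \<open>Z\<close> and radius \<open>\<rho>\<close>;
  meaningful only for \<open>X \<noteq> Z\<close>.\<close>

definition circle_inverse :: "real \<times> real \<Rightarrow> real \<Rightarrow> real \<times> real \<Rightarrow> real \<times> real" where
  "circle_inverse Z \<rho> X = Z + (\<rho>\<^sup>2 / (dist Z X)\<^sup>2) *\<^sub>R (X - Z)"

definition X36 :: "real \<times> real \<Rightarrow> real \<times> real \<Rightarrow> real \<times> real \<Rightarrow> real \<times> real" where
  "X36 P Q R = circle_inverse (circumcenter P Q R) (circumradius P Q R) (incenter P Q R)"

text \<open>Equilateral triangles are left out, since their incenter and circumcenter coincide and
  \<open>X36\<close> is at infinity.\<close>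

definition locus_X36 :: "real \<Rightarrow> real \<Rightarrow> real \<times> real \<Rightarrow> (real \<times> real) set" where
  "locus_X36 a b C =
     {X36 P Q R | P Q R. (P, Q, R) \<in> poncelet_family a b C \<and> \<not> equilateral P Q R}"

end

theory Submission
  imports Defs "HOL-Computational_Algebra.Fundamental_Theorem_Algebra"
begin

text \<open>
  Scale the ellipse to the unit circle by \<open>(x, y) \<mapsto> u = x / a + i y / b\<close>.  The circle becomes an ellipse with
  center \<open>z\<close> and foci \<open>f, g\<close>, and the triangles around it become the fibres over the unit circle of the
  Blaschke product \<open>u (u - f) (u - g) / ((1 - f* u) (1 - g* u))\<close>, a star denoting conjugation; so the
  elementary symmetric functions of the vertices are affine in the parameter, the product of the
  vertices.  Hence the circumcenter \<open>O\<close> and the power \<open>2 R r\<close> of \<open>C\<close> with respect to the circumcircle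
  are affine in it too, and since \<open>|O - C|\<^sup>2 = R\<^sup>2 - 2 R r\<close> (Euler),
  \<open>X\<^sub>3\<^sub>6 - C = - 2 r (O - C) / (R - 2 r)\<close> is a projective image of the parameter circle.  For \<open>C\<close> on
  the given ellipse the equilateral triangle of the family makes \<open>O - C\<close> vanish, and \<open>R - 2 r\<close> vanish
  to second order, so that the conic degenerates to a line, parametrized by \<open>cot (\<theta> / 2)\<close> with \<open>\<theta>\<close>
  the angle to the parameter of the equilateral triangle.
\<close>

subsection \<open>Tangent lines and triangle centers\<close>

lemma ex1_quadratic_root_iff:
  fixes d e f :: real
  assumes "d > 0"
  shows "(\<exists>!t. d * t\<^sup>2 + 2 * e * t + f = 0) \<longleftrightarrow> e\<^sup>2 = d * f"
proof
  have sq: "d * (d * t\<^sup>2 + 2 * e * t + f) = (d * t + e)\<^sup>2 - (e\<^sup>2 - d * f)" for t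
    by (simp add: power2_eq_square algebra_simps)
  have iff: "d * t\<^sup>2 + 2 * e * t + f = 0 \<longleftrightarrow> (d * t + e)\<^sup>2 = e\<^sup>2 - d * f" for t
    using sq[of t] assms by auto
  show "e\<^sup>2 = d * f" if "\<exists>!t. d * t\<^sup>2 + 2 * e * t + f = 0"
  proof -
    from that obtain t where t: "(d * t + e)\<^sup>2 = e\<^sup>2 - d * f"
      and uniq: "\<And>t'. (d * t' + e)\<^sup>2 = e\<^sup>2 - d * f \<Longrightarrow> t' = t"
      unfolding iff by blast
    \<comment> \<open>\<open>- 2 * e / d - t\<close> is the mirror image of the root
      \<open>t\<close> in the vertex \<open>- e / d\<close> of the parabola. It is a root as well,
      so uniqueness puts \<open>t\<close> at the vertex.\<close>
    have "d * (- 2 * e / d - t) + e = - (d * t + e)"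
      using assms by (simp add: field_simps)
    then have "(d * (- 2 * e / d - t) + e)\<^sup>2 = e\<^sup>2 - d * f"
      using t by (metis power2_minus)
    then have "- 2 * e / d - t = t" by (rule uniq)
    then have "d * t + e = 0" using assms by (simp add: field_simps)
    then show ?thesis using t by simp
  qed
  show "\<exists>!t. d * t\<^sup>2 + 2 * e * t + f = 0" if "e\<^sup>2 = d * f"
    unfolding iff using that assms
    by (intro ex1I[of _ "- e / d"]) (auto simp: field_simps)
qed

lemma dist_affine_square:
  fixes P Q C :: "'a :: real_inner"
  shows "(dist C (P + t *\<^sub>R (Q - P)))\<^sup>2 =
    (dist P Q)\<^sup>2 * t\<^sup>2 + 2 * ((Q - P) \<bullet> (P - C)) * t + (dist C P)\<^sup>2"
proof -
  have "dist C (P + t *\<^sub>R (Q - P)) = norm ((P - C) + t *\<^sub>R (Q - P))"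
    "dist C P = norm (P - C)" "dist P Q = norm (Q - P)"
    by (simp_all add: dist_norm norm_minus_commute algebra_simps)
  moreover have "(norm (x + t *\<^sub>R y))\<^sup>2 = (norm y)\<^sup>2 * t\<^sup>2 + 2 * (y \<bullet> x) * t + (norm x)\<^sup>2"
    for x y :: 'a
    unfolding power2_norm_eq_inner inner_add_left inner_add_right inner_scaleR_left inner_scaleR_right inner_commute[of x y]
    by (simp add: power2_eq_square algebra_simps)
  ultimately show ?thesis by simp
qed

lemma ex1_in_range_iff:
  assumes "inj h"
  shows "(\<exists>!x. x \<in> range h \<and> x \<in> S) \<longleftrightarrow> (\<exists>!t. h t \<in> S)"
  using assms unfolding inj_def by blast

lemma line_tangent_eq_ex1_param:
  fixes P Q C :: "real \<times> real"
  assumes "P \<noteq> Q" "r > 0"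
  shows "line_tangent P Q C r \<longleftrightarrow>
    (\<exists>!t. (dist P Q)\<^sup>2 * t\<^sup>2 + 2 * ((Q - P) \<bullet> (P - C)) * t + ((dist C P)\<^sup>2 - r\<^sup>2) = 0)"
proof -
  have on: "P + t *\<^sub>R (Q - P) \<in> sphere C r \<longleftrightarrow>
      (dist P Q)\<^sup>2 * t\<^sup>2 + 2 * ((Q - P) \<bullet> (P - C)) * t + ((dist C P)\<^sup>2 - r\<^sup>2) = 0" for t
  proof -
    have "P + t *\<^sub>R (Q - P) \<in> sphere C r \<longleftrightarrow> (dist C (P + t *\<^sub>R (Q - P)))\<^sup>2 = r\<^sup>2"
      using assms(2) by (simp add: power2_eq_iff_nonneg)
    then show ?thesis unfolding dist_affine_square by auto
  qed
  have inj: "P + t *\<^sub>R (Q - P) = P + t' *\<^sub>R (Q - P) \<longleftrightarrow> t = t'" for t t'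
    using assms by simp
  show ?thesis
    unfolding line_tangent_def affine_hull_2_alt on[symmetric]
    by (rule ex1_in_range_iff) (simp only: inj inj_def simp_thms)
qed

text \<open>Lagrange's identity in the plane; it turns the discriminant of the tangency quadratic
  into a cross product.\<close>

lemma cross_square:
  fixes v w :: "real \<times> real"
  shows "(fst v * snd w - snd v * fst w)\<^sup>2 = (norm v)\<^sup>2 * (norm w)\<^sup>2 - (v \<bullet> w)\<^sup>2"
  by (cases v; cases w) (simp add: norm_Pair power2_eq_square algebra_simps)

text \<open>The cross product is, up to sign, twice the area of the triangle \<open>C P Q\<close>,
  so the equation puts the line \<open>P Q\<close> at distance \<open>r\<close> from
  \<open>C\<close>.\<close>

lemma line_tangent_iff:
  fixes P Q C :: "real \<times> real"
  assumes "P \<noteq> Q" "r > 0"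
  shows "line_tangent P Q C r \<longleftrightarrow>
    (fst (Q - P) * snd (P - C) - snd (Q - P) * fst (P - C))\<^sup>2 = r\<^sup>2 * (dist P Q)\<^sup>2"
proof -
  have "(dist P Q)\<^sup>2 > 0" using assms by simp
  then show ?thesis
    unfolding line_tangent_eq_ex1_param[OF assms] ex1_quadratic_root_iff[OF \<open>(dist P Q)\<^sup>2 > 0\<close>]
      cross_square
    by (auto simp: dist_norm norm_minus_commute algebra_simps)
qed

text \<open>The double root gives the foot of the perpendicular from \<open>C\<close>, and
  Pythagoras the tangent lengths. Nothing yet confines \<open>t\<close> to the segment, so these
  lengths carry signs.\<close>

lemma line_tangent_touching_point:
  fixes P Q C :: "real \<times> real"
  assumes "P \<noteq> Q" "r > 0" "line_tangent P Q C r"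
  obtains t where "dist C (P + t *\<^sub>R (Q - P)) = r"
    and "(dist C P)\<^sup>2 = r\<^sup>2 + (t * dist P Q)\<^sup>2" and "(dist C Q)\<^sup>2 = r\<^sup>2 + ((1 - t) * dist P Q)\<^sup>2"
proof -
  define d e where "d = (dist P Q)\<^sup>2" and "e = (Q - P) \<bullet> (P - C)"
  have d: "d > 0" using assms by (simp add: d_def)
  have e2: "e\<^sup>2 = d * ((dist C P)\<^sup>2 - r\<^sup>2)"
    using assms(3) ex1_quadratic_root_iff[OF d]
    unfolding line_tangent_eq_ex1_param[OF assms(1,2)] d_def e_def by blast
  define t where "t = - e / d"
  have te: "e = - t * d" using d by (simp add: t_def)
  have CP: "(dist C P)\<^sup>2 = r\<^sup>2 + t\<^sup>2 * d"
    using e2 d unfolding te by (simp add: power2_eq_square)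
  note along = dist_affine_square[of C P _ Q, folded d_def e_def]
  have "(dist C (P + t *\<^sub>R (Q - P)))\<^sup>2 = r\<^sup>2"
    unfolding along CP te by (simp add: power2_eq_square algebra_simps)
  then have "dist C (P + t *\<^sub>R (Q - P)) = r"
    using assms(2) by (simp add: power2_eq_iff_nonneg)
  moreover have "(dist C Q)\<^sup>2 = r\<^sup>2 + ((1 - t) * dist P Q)\<^sup>2"
    using along[of 1] CP unfolding te power_mult_distrib d_def[symmetric]
    by (simp add: power2_eq_square algebra_simps)
  ultimately show thesis
    using that[of t] CP by (simp add: power_mult_distrib d_def)
qed

section \<open>Circumcenter, incenter and equilateral triangles\<close>

lemma perp_to_noncollinear:
  fixes P Q R J :: "real \<times> real"
  assumes "\<not> collinear {P, Q, R}" "J \<bullet> P = J \<bullet> Q" "J \<bullet> Q = J \<bullet> R"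
  shows "J = 0"
proof (rule ccontr)
  assume "J \<noteq> 0"
  obtain j1 j2 where J: "J = (j1, j2)" by (cases J)
  have pos: "j1\<^sup>2 + j2\<^sup>2 \<noteq> 0" using \<open>J \<noteq> 0\<close> J by (auto simp: sum_power2_eq_zero_iff zero_prod_def)
  have "collinear {P, Q, R}"
    unfolding collinear_def
  \<comment> \<open>The quarter turn of \<open>J\<close>: in the plane every vector orthogonal to
    \<open>J\<close> is a multiple of it.\<close>
  proof (intro exI[of _ "(- j2, j1)"] ballI)
    fix x y assume "x \<in> {P, Q, R}" "y \<in> {P, Q, R}"
    then have perp: "J \<bullet> (x - y) = 0" using assms(2,3) by (auto simp: inner_diff_right)
    obtain d1 d2 where d: "x - y = (d1, d2)" by (cases "x - y")
    have z: "j1 * d1 + j2 * d2 = 0" using perp d J by simp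
    have "d1 * (j1\<^sup>2 + j2\<^sup>2) = (j1 * d2 - j2 * d1) * - j2" "d2 * (j1\<^sup>2 + j2\<^sup>2) = (j1 * d2 - j2 * d1) * j1"
      using z by algebra+
    then have "x - y = ((j1 * d2 - j2 * d1) / (j1\<^sup>2 + j2\<^sup>2)) *\<^sub>R (- j2, j1)"
      using pos d by (simp add: field_simps)
    then show "\<exists>c. x - y = c *\<^sub>R (- j2, j1)" by blast
  qed
  then show False using assms by simp
qed

lemma circumcenter_eqI:
  assumes "\<not> collinear {P, Q, R}" "dist Z P = dist Z Q" "dist Z Q = dist Z R"
  shows "circumcenter P Q R = Z"
  unfolding circumcenter_def
proof (rule the_equality)
  fix W assume W: "dist W P = dist W Q \<and> dist W Q = dist W R"
  \<comment> \<open>The difference of the squared distances from \<open>S\<close> to two fixed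
    points is affine in \<open>S\<close>. As it takes the same value at all vertices,
    \<open>W - Z\<close> is orthogonal to all sides.\<close>
  have *: "2 * ((W - Z) \<bullet> S) = (norm W)\<^sup>2 - (norm Z)\<^sup>2 - (dist W S)\<^sup>2 + (dist Z S)\<^sup>2" for S
    by (simp add: dist_norm power2_norm_eq_inner inner_diff_left inner_diff_right inner_commute
        algebra_simps)
  have "(W - Z) \<bullet> P = (W - Z) \<bullet> Q" "(W - Z) \<bullet> Q = (W - Z) \<bullet> R"
    using *[of P] *[of Q] *[of R] W assms by auto
  then show "W = Z" using perp_to_noncollinear[OF assms(1)] by fastforce
qed (use assms in auto)

text \<open>\<open>u\<close>, \<open>v\<close>, \<open>w\<close> are the tangent lengths at
  \<open>P\<close>, \<open>Q\<close>, \<open>R\<close>, and \<open>g\<close> is the squared radius.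
  Measured from \<open>C\<close>, the sum \<open>J\<close> of the vertices weighted by the opposite
  sides has the same inner product with all three of them, hence vanishes.\<close>

lemma incenter_eqI:
  assumes "\<not> collinear {P, Q, R}" "u > 0" "v > 0" "w > 0"
    and d: "dist P Q = u + v" "dist Q R = v + w" "dist R P = w + u"
    and g: "(dist C P)\<^sup>2 = g + u\<^sup>2" "(dist C Q)\<^sup>2 = g + v\<^sup>2" "(dist C R)\<^sup>2 = g + w\<^sup>2"
  shows "incenter P Q R = C"
proof -
  define p q r where "p = P - C" and "q = Q - C" and "r = R - C"
  have sq: "p \<bullet> p = g + u\<^sup>2" "q \<bullet> q = g + v\<^sup>2" "r \<bullet> r = g + w\<^sup>2"
    using g by (simp_all add: p_def q_def r_def dist_norm norm_minus_commute[of C] power2_norm_eq_inner)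
  have polar: "2 * (x \<bullet> y) = x \<bullet> x + y \<bullet> y - (norm (x - y))\<^sup>2" for x y :: "real \<times> real"
    by (simp add: power2_norm_eq_inner inner_diff_left inner_diff_right inner_commute)
  have nd: "norm (p - q) = u + v" "norm (q - r) = v + w" "norm (r - p) = w + u"
    using d by (simp_all add: p_def q_def r_def dist_norm)
  have prods: "p \<bullet> q = g - u * v" "q \<bullet> r = g - v * w" "r \<bullet> p = g - w * u"
    using polar[of p q] polar[of q r] polar[of r p] unfolding nd sq
    by (simp_all add: power2_eq_square algebra_simps)
  define J where "J = (v + w) *\<^sub>R p + (w + u) *\<^sub>R q + (u + v) *\<^sub>R r"
  have "J \<bullet> p = 2 * (u + v + w) * g - 2 * u * v * w"
       "J \<bullet> q = 2 * (u + v + w) * g - 2 * u * v * w"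
       "J \<bullet> r = 2 * (u + v + w) * g - 2 * u * v * w"
    by (simp_all add: J_def inner_add_left sq prods inner_commute[of q p] inner_commute[of r q]
        inner_commute[of p r] power2_eq_square algebra_simps)
  then have "J \<bullet> P = J \<bullet> Q" "J \<bullet> Q = J \<bullet> R"
    by (auto simp: p_def q_def r_def inner_diff_right)
  then have "J = 0" using perp_to_noncollinear assms(1) by blast
  have "(v + w) *\<^sub>R P + (w + u) *\<^sub>R Q + (u + v) *\<^sub>R R = J + (2 * (u + v + w)) *\<^sub>R C"
    by (simp add: J_def p_def q_def r_def algebra_simps scaleR_2[symmetric] flip: scaleR_add_left)
  then have "incenter P Q R = (1 / (2 * (u + v + w))) *\<^sub>R ((2 * (u + v + w)) *\<^sub>R C)"
    unfolding incenter_def d \<open>J = 0\<close> by (simp add: algebra_simps)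
  then show ?thesis using assms(2-4) by simp
qed

text \<open>Seen from \<open>C\<close>, two vertices add up to minus the third, so by the
  parallelogram law every squared side is three times the squared circumradius.\<close>

lemma equilateral_if_centroid_eq_circumcenter:
  assumes "P + Q + R = 3 *\<^sub>R C" "dist C P = dist C Q" "dist C Q = dist C R"
  shows "equilateral P Q R"
proof -
  have side: "(dist S T)\<^sup>2 = 3 * (dist C P)\<^sup>2"
    if "S + T + U = 3 *\<^sub>R C" "dist C S = dist C P" "dist C T = dist C P" "dist C U = dist C P"
    for S T U
  proof -
    have sum: "(S - C) + (T - C) = C - U"
      using that(1) scaleR_add_left[of 1 2 C] by (simp add: algebra_simps scaleR_2)
    have "(norm (x - y))\<^sup>2 = 2 * (norm x)\<^sup>2 + 2 * (norm y)\<^sup>2 - (norm (x + y))\<^sup>2"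
      for x y :: "real \<times> real"
      unfolding power2_norm_eq_inner inner_diff_left inner_diff_right inner_add_left inner_add_right
      by simp
    from this[of "S - C" "T - C"]
    have "(norm (S - T))\<^sup>2 = 2 * (norm (S - C))\<^sup>2 + 2 * (norm (T - C))\<^sup>2 - (norm (C - U))\<^sup>2"
      unfolding sum by simp
    then show ?thesis
      using that(2-4)
      unfolding dist_norm norm_minus_commute[of C S] norm_minus_commute[of C T] by simp
  qed
  have "(dist P Q)\<^sup>2 = (dist Q R)\<^sup>2" "(dist Q R)\<^sup>2 = (dist R P)\<^sup>2"
    using side[of P Q R] side[of Q R P] side[of R P Q] assms by (metis add.assoc add.commute)+
  then show ?thesis unfolding equilateral_def by (metis power2_eq_imp_eq zero_le_dist)
qed

subsection \<open>Blaschke products of degree three\<close>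

text \<open>Divided differences: the differences of the cubic at two roots, and then of the
  quotients, contain nonzero differences of roots as factors.\<close>

lemma vieta_cubic:
  fixes u v w :: "'a :: field"
  assumes "u \<noteq> v" "v \<noteq> w" "w \<noteq> u"
    and "u^3 - s1 * u\<^sup>2 + s2 * u - s3 = 0" "v^3 - s1 * v\<^sup>2 + s2 * v - s3 = 0"
        "w^3 - s1 * w\<^sup>2 + s2 * w - s3 = 0"
  shows "u + v + w = s1" "u * v + v * w + w * u = s2"
proof -
  have "(u - v) * (u\<^sup>2 + u * v + v\<^sup>2 - s1 * (u + v) + s2) = 0"
    using assms(4,5) by algebra
  then have 1: "u\<^sup>2 + u * v + v\<^sup>2 - s1 * (u + v) + s2 = 0" using assms(1) by simp
  have "(v - w) * (v\<^sup>2 + v * w + w\<^sup>2 - s1 * (v + w) + s2) = 0"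
    using assms(5,6) by algebra
  then have 2: "v\<^sup>2 + v * w + w\<^sup>2 - s1 * (v + w) + s2 = 0" using assms(2) by simp
  have "(u - w) * (u + v + w - s1) = 0" using 1 2 by algebra
  then show "u + v + w = s1" using assms(3) by simp
  then show "u * v + v * w + w * u = s2"
    using 1 by (auto simp: power2_eq_square algebra_simps)
qed

text \<open>Vanishes when the chord \<open>u v\<close> of the unit circle touches the ellipse with center \<open>z\<close>, focal
  parameter \<open>k\<close> (the foci are the roots of \<open>(x - z)\<^sup>2 + k\<close>) and sum \<open>m\<close> of the squared semi-axes.\<close>

definition chord_conic :: "complex \<Rightarrow> complex \<Rightarrow> complex \<Rightarrow> complex \<Rightarrow> complex \<Rightarrow> complex" where
  "chord_conic z k m u v =
     (z + u * v * cnj z - (u + v))\<^sup>2 + k * (1 + (u * v)\<^sup>2) - 2 * m * (u * v)"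

text \<open>\<open>q\<close> is the product of the foci. The first two summands cancel once a third
  vertex completes the chord to a triangle with the Blaschke symmetric functions; what remains is
  \<open>u * v\<close> times the closing condition, in which the chord does not occur.\<close>

lemma chord_conic_factor:
  assumes "cnj k = k" "q = z\<^sup>2 + k"
  shows "chord_conic z k m u v =
    (u + v - 2 * z) * (u + v - 2 * (u * v) * cnj z) + (q - u * v) * (1 - u * v * cnj q)
      + u * v * (1 + q * cnj q - 2 * z * cnj z - 2 * m)"
proof -
  have "cnj q = (cnj z)\<^sup>2 + k" using assms by simp
  then show ?thesis unfolding chord_conic_def using assms(2) by algebra
qed

lemma chord_conic_triangle:
  assumes "cnj k = k" "q = z\<^sup>2 + k" "1 + q * cnj q = 2 * (z * cnj z + m)" "w \<noteq> 0"
    and "u + v + w = 2 * z + u * v * w * cnj q"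
    and "u * v + v * w + w * u = q + 2 * (u * v * w) * cnj z"
  shows "chord_conic z k m u v = 0"
proof -
  have "w * (u + v - 2 * z) * (u + v - 2 * (u * v) * cnj z) + w * (q - u * v) * (1 - u * v * cnj q) = 0"
    using assms(5,6) by algebra
  then have "(u + v - 2 * z) * (u + v - 2 * (u * v) * cnj z) + (q - u * v) * (1 - u * v * cnj q) = 0"
    using assms(4) by (simp flip: distrib_left add: mult.assoc)
  then show ?thesis unfolding chord_conic_factor[OF assms(1,2)] using assms(3) by simp
qed

text \<open>Two tangent chords issue from each vertex. Vieta for their far endpoints yields the
  Blaschke equation for that vertex, and Vieta for its three solutions the symmetric
  functions.\<close>

lemma chord_conic_triangle_converse:
  assumes "cnj k = k" "q = z\<^sup>2 + k" "u \<noteq> 0" "v \<noteq> 0" "w \<noteq> 0" "u \<noteq> v" "v \<noteq> w" "w \<noteq> u"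
    and "chord_conic z k m u v = 0" "chord_conic z k m v w = 0" "chord_conic z k m w u = 0"
  shows "u + v + w = 2 * z + u * v * w * cnj q"
    and "u * v + v * w + w * u = q + 2 * (u * v * w) * cnj z"
    and "1 + q * cnj q = 2 * (z * cnj z + m)"
proof -
  have cq: "cnj q = (cnj z)\<^sup>2 + k" using assms by simp
  have sym: "chord_conic z k m x y = chord_conic z k m y x" for x y
    by (simp add: chord_conic_def algebra_simps)
  have root: "x^3 - (2 * z + x * y * t * cnj q) * x\<^sup>2 + (q + 2 * (x * y * t) * cnj z) * x - x * y * t = 0"
    if "y \<noteq> t" and e: "chord_conic z k m x y = 0" "chord_conic z k m x t = 0" for x y t
  proof -
    \<comment> \<open>For fixed \<open>x\<close> the conic is quadratic in the other endpoint, with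
      roots \<open>y\<close> and \<open>t\<close>. Subtracting the two equations yields the sum of
      the roots, and substituting back their product.\<close>
    have "(y - t) * (((x * cnj z - 1)\<^sup>2 + k * x\<^sup>2) * (y + t) + 2 * (z - x) * (x * cnj z - 1) - 2 * m * x) = 0"
      using e unfolding chord_conic_def by algebra
    then have "((x * cnj z - 1)\<^sup>2 + k * x\<^sup>2) * (y + t) + 2 * (z - x) * (x * cnj z - 1) - 2 * m * x = 0"
      using that(1) by simp
    then have "(z - x)\<^sup>2 + k = ((x * cnj z - 1)\<^sup>2 + k * x\<^sup>2) * y * t"
      using e(1) unfolding chord_conic_def by algebra
    then show ?thesis using assms(2) cq by algebra
  qed
  define l where "l = u * v * w"
  have perm: "v * w * u = l" "w * u * v = l" "u * v * w = l" by (simp_all add: l_def)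
  have ru: "u^3 - (2 * z + l * cnj q) * u\<^sup>2 + (q + 2 * l * cnj z) * u - l = 0"
    using root[of v w u] assms sym unfolding perm by simp
  have rv: "v^3 - (2 * z + l * cnj q) * v\<^sup>2 + (q + 2 * l * cnj z) * v - l = 0"
    using root[of w u v] assms sym unfolding perm by simp
  have rw: "w^3 - (2 * z + l * cnj q) * w\<^sup>2 + (q + 2 * l * cnj z) * w - l = 0"
    using root[of u v w] assms sym unfolding perm by simp
  note V = vieta_cubic[OF assms(6,7,8) ru rv rw]
  show 1: "u + v + w = 2 * z + u * v * w * cnj q" using V(1) by (simp add: l_def)
  show 2: "u * v + v * w + w * u = q + 2 * (u * v * w) * cnj z" using V(2) by (simp add: l_def)
  have "w * (u + v - 2 * z) * (u + v - 2 * (u * v) * cnj z) + w * (q - u * v) * (1 - u * v * cnj q) = 0"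
    using 1 2 by algebra
  then have "w * (u * v * (1 + q * cnj q - 2 * z * cnj z - 2 * m)) = 0"
    using assms(9) unfolding chord_conic_factor[OF assms(1,2)] by algebra
  then have "1 + q * cnj q - 2 * z * cnj z - 2 * m = 0" using assms(3-5) by simp
  then show "1 + q * cnj q = 2 * (z * cnj z + m)" by (simp add: algebra_simps)
qed

section \<open>Fibres of a Blaschke product over the unit circle\<close>

lemma cubic_splits:
  fixes s1 s2 s3 :: complex
  obtains u v w where "u + v + w = s1" "u * v + v * w + w * u = s2" "u * v * w = s3"
proof -
  define p where "p = [:- s3, s2, - s1, 1:]"
  obtain A where A: "size A = degree p" "p = smult (lead_coeff p) (\<Prod>x\<in>#A. [:- x, 1:])"
    using alg_closed_imp_factorization[of p] by (auto simp: p_def)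
  have "size A = 3" using A by (simp add: p_def)
  then obtain u B where B: "A = add_mset u B" "size B = 2"
    using size_eq_Suc_imp_eq_union[of A 2] by auto
  then obtain v D where D: "B = add_mset v D" "size D = 1"
    using size_eq_Suc_imp_eq_union[of B 1] by auto
  then obtain w where "D = {#w#}"
    using size_1_singleton_mset by blast
  then have "A = {#u, v, w#}" using B D by simp
  then have "[:- s3, s2, - s1, 1:] = [:- u, 1:] * [:- v, 1:] * [:- w, 1:]"
    using A(2) by (simp add: p_def algebra_simps)
  also have "\<dots> = [:- (u * v * w), u * v + v * w + w * u, - (u + v + w), 1:]"
    by (simp add: algebra_simps)
  finally show thesis using that[of u v w] by (auto simp: minus_equation_iff[of s1])
qed

text \<open>For \<open>norm f < 1\<close>, the factor \<open>(x - f) / (1 - cnj f * x)\<close> thus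
  has modulus below 1 inside the unit disc and above 1 outside.\<close>

lemma norm_blaschke_diff:
  fixes f x :: complex
  shows "(norm (1 - cnj f * x))\<^sup>2 - (norm (x - f))\<^sup>2 = (1 - (norm x)\<^sup>2) * (1 - (norm f)\<^sup>2)"
  unfolding cmod_power2 by (simp add: power2_eq_square algebra_simps)

text \<open>Off the circle the moduli of all three Blaschke factors, \<open>x\<close> itself
  included, lie on the same side of 1, so the product is not unimodular there.\<close>

lemma blaschke_root_on_circle:
  fixes f g l x :: complex
  assumes "norm f < 1" "norm g < 1" "norm l = 1"
    and eq: "x * (x - f) * (x - g) = l * ((1 - cnj f * x) * (1 - cnj g * x))"
  shows "norm x = 1"
proof -
  have n: "norm x * norm (x - f) * norm (x - g) = norm (1 - cnj f * x) * norm (1 - cnj g * x)"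
    using arg_cong[OF eq, of norm] assms(3) by (simp add: norm_mult)
  have pos: "0 < 1 - (norm h)\<^sup>2" if "norm h < 1" for h :: complex
    using that by (simp add: abs_square_less_1)
  have lt: "norm (x - h) < norm (1 - cnj h * x)" if "norm x < 1" "norm h < 1" for h
  proof -
    have "(norm (x - h))\<^sup>2 < (norm (1 - cnj h * x))\<^sup>2"
      using norm_blaschke_diff[of h x] mult_pos_pos[OF pos[OF that(1)] pos[OF that(2)]] by linarith
    then show ?thesis by (simp add: power_less_imp_less_base)
  qed
  have gt: "norm (1 - cnj h * x) < norm (x - h)" if "norm x > 1" "norm h < 1" for h
  proof -
    have "1 - (norm x)\<^sup>2 < 0" using that(1) by (simp add: power_less_one_iff one_less_power)
    then have "(norm (1 - cnj h * x))\<^sup>2 < (norm (x - h))\<^sup>2"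
      using norm_blaschke_diff[of h x] mult_neg_pos[OF _ pos[OF that(2)]] by smt
    then show ?thesis by (simp add: power_less_imp_less_base)
  qed
  show ?thesis
  proof (rule linorder_cases[of "norm x" 1])
    assume x: "norm x < 1"
    have "norm (x - f) * norm (x - g) < norm (1 - cnj f * x) * norm (1 - cnj g * x)"
      using lt[OF x assms(1)] lt[OF x assms(2)] by (simp add: mult_strict_mono')
    moreover have "norm x * (norm (x - f) * norm (x - g)) \<le> 1 * (norm (x - f) * norm (x - g))"
      using x by (intro mult_right_mono) auto
    ultimately show ?thesis using n by (simp add: mult.assoc)
  next
    assume x: "norm x > 1"
    have "norm (1 - cnj f * x) * norm (1 - cnj g * x) < norm (x - f) * norm (x - g)"
      using gt[OF x assms(1)] gt[OF x assms(2)] by (simp add: mult_strict_mono')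
    moreover have "1 * (norm (x - f) * norm (x - g)) \<le> norm x * (norm (x - f) * norm (x - g))"
      using x by (intro mult_right_mono) auto
    ultimately show ?thesis using n by (simp add: mult.assoc)
  qed
qed

text \<open>On the unit circle the logarithmic derivative \<open>u B' / B\<close> of the Blaschke
  product \<open>B\<close> is \<open>1 + (1 - |f|^2) / |u - f|^2 + (1 - |g|^2) / |u - g|^2\<close>,
  which is positive; at a double root it would vanish.\<close>

lemma blaschke_root_simple:
  fixes f g l u w :: complex
  assumes "norm f < 1" "norm g < 1" "norm u = 1" "norm l = 1"
    and s: "u + u + w = f + g + l * (cnj f * cnj g)" "u * u + u * w + w * u = f * g + l * (cnj f + cnj g)"
      "u * u * w = l"
  shows False
proof -
  have uu: "u * cnj u = 1" using assms(3) by (simp add: complex_norm_square[symmetric])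
  have "u \<noteq> f" "u \<noteq> g" "u \<noteq> 0" using assms(1-3) by auto
  define F G where "F = u - f" and "G = u - g"
  have FG: "F \<noteq> 0" "G \<noteq> 0" using \<open>u \<noteq> f\<close> \<open>u \<noteq> g\<close> by (auto simp: F_def G_def)
  have cF: "cnj F = cnj u - cnj f" "cnj G = cnj u - cnj g" by (simp_all add: F_def G_def)
  \<comment> \<open>\<open>e0\<close> is the Blaschke equation at \<open>u\<close>, and
    \<open>e1\<close> its derivative, which holds because \<open>u\<close> is a double root.\<close>
  have e0: "u * F * G = l * ((1 - cnj f * u) * (1 - cnj g * u))"
    using s unfolding F_def G_def by algebra
  have e1: "F * G + u * (F + G) = - l * (cnj f * (1 - cnj g * u) + cnj g * (1 - cnj f * u))"
    using s unfolding F_def G_def by algebra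
  have fl: "1 - cnj f * u = u * cnj F" "1 - cnj g * u = u * cnj G"
    using uu unfolding cF by algebra+
  have F0: "F * G = l * u * (cnj F * cnj G)"
  proof -
    have "u * (F * G) = u * (l * u * (cnj F * cnj G))" using e0 unfolding fl by (simp add: algebra_simps)
    then show ?thesis using \<open>u \<noteq> 0\<close> by simp
  qed
  have e1': "F * G + u * (F + G) = - (l * u) * (cnj f * cnj G + cnj g * cnj F)"
    using e1 unfolding fl by (simp add: algebra_simps)
  have "(F * G + u * (F + G)) * (cnj F * cnj G) = - (F * G) * (cnj f * cnj G + cnj g * cnj F)"
    using e1' F0 by algebra
  then have "F * cnj F * (G * cnj G) + (u * cnj F + F * cnj f) * (G * cnj G) + (u * cnj G + G * cnj g) * (F * cnj F) = 0"
    by algebra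
  moreover have "u * cnj F + F * cnj f = 1 - f * cnj f" "u * cnj G + G * cnj g = 1 - g * cnj g"
    using uu unfolding cF unfolding F_def G_def by algebra+
  \<comment> \<open>The logarithmic derivative multiplied by the squared moduli of \<open>F\<close>
    and \<open>G\<close>.\<close>
  ultimately have "of_real ((norm F)\<^sup>2 * (norm G)\<^sup>2 + (1 - (norm f)\<^sup>2) * (norm G)\<^sup>2
      + (1 - (norm g)\<^sup>2) * (norm F)\<^sup>2) = (0 :: complex)"
    by (simp only: of_real_add of_real_mult of_real_diff complex_norm_square of_real_1)
  then have "(norm F)\<^sup>2 * (norm G)\<^sup>2 + (1 - (norm f)\<^sup>2) * (norm G)\<^sup>2
      + (1 - (norm g)\<^sup>2) * (norm F)\<^sup>2 = 0"
    by (simp only: of_real_eq_0_iff)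
  moreover have "0 < 1 - (norm f)\<^sup>2" "0 < 1 - (norm g)\<^sup>2" "0 < (norm F)\<^sup>2" "0 < (norm G)\<^sup>2"
    using assms(1,2) FG by (simp_all add: abs_square_less_1)
  ultimately show False by (smt (verit) mult_pos_pos)
qed

subsection \<open>Chords of the ellipse\<close>

definition ellipse_point :: "real \<Rightarrow> real \<Rightarrow> complex \<Rightarrow> real \<times> real" where
  "ellipse_point a b u = (a * Re u, b * Im u)"

lemma ellipse_point_in_ellipse_iff:
  assumes "a > 0" "b > 0"
  shows "ellipse_point a b u \<in> ellipse a b \<longleftrightarrow> norm u = 1"
proof -
  have "ellipse_point a b u \<in> ellipse a b \<longleftrightarrow> (norm u)\<^sup>2 = 1"
    using assms by (simp add: ellipse_point_def ellipse_def power_mult_distrib cmod_power2)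
  then show ?thesis by (simp add: power2_eq_1_iff) (use norm_ge_zero[of u] in linarith)
qed

lemma ellipse_point_in_interior_iff:
  assumes "a > 0" "b > 0"
  shows "ellipse_point a b u \<in> ellipse_interior a b \<longleftrightarrow> norm u < 1"
proof -
  have "ellipse_point a b u \<in> ellipse_interior a b \<longleftrightarrow> (norm u)\<^sup>2 < 1"
    using assms by (simp add: ellipse_point_def ellipse_interior_def power_mult_distrib cmod_power2)
  then show ?thesis by (simp add: abs_square_less_1)
qed

lemma ellipse_point_surj:
  assumes "a > 0" "b > 0"
  obtains u where "P = ellipse_point a b u"
proof (cases P)
  case (Pair x y)
  then have "P = ellipse_point a b (Complex (x / a) (y / b))"
    using assms by (simp add: ellipse_point_def)
  then show thesis by (rule that)
qed

lemma ellipse_point_eq_iff: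
  assumes "a > 0" "b > 0"
  shows "ellipse_point a b u = ellipse_point a b v \<longleftrightarrow> u = v"
  using assms by (auto simp: ellipse_point_def complex_eq_iff)

lemma ellipse_point_affine:
  "ellipse_point a b u + t *\<^sub>R (ellipse_point a b v - ellipse_point a b u) =
    ellipse_point a b (u + t *\<^sub>R (v - u))"
  by (simp add: ellipse_point_def algebra_simps)

text \<open>The power of a point of the chord with respect to the unit sphere is the signed product
  of the segments it cuts off, so its sign decides between inside and outside.\<close>

lemma norm_chord_square:
  fixes u v :: "'a :: real_inner"
  assumes "norm u = 1" "norm v = 1"
  shows "(norm (u + t *\<^sub>R (v - u)))\<^sup>2 = 1 - t * (1 - t) * (norm (v - u))\<^sup>2"
proof -
  have "u \<bullet> u = 1" "v \<bullet> v = 1" using assms by (simp_all add: norm_eq_1)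
  then show ?thesis
    unfolding power2_norm_eq_inner
    by (simp add: inner_diff_left inner_diff_right inner_add_left
        inner_add_right inner_commute[of v u] algebra_simps)
qed

lemma ellipse_points_noncollinear:
  assumes "a > 0" "b > 0" "norm u = 1" "norm v = 1" "norm w = 1" "u \<noteq> v" "v \<noteq> w" "w \<noteq> u"
  shows "\<not> collinear {ellipse_point a b u, ellipse_point a b v, ellipse_point a b w}"
proof
  assume "collinear {ellipse_point a b u, ellipse_point a b v, ellipse_point a b w}"
  then have "ellipse_point a b w \<in> affine hull {ellipse_point a b u, ellipse_point a b v}"
    using collinear_3_affine_hull ellipse_point_eq_iff[OF assms(1,2)] assms(6) by metis
  then obtain t where "ellipse_point a b w = ellipse_point a b (u + t *\<^sub>R (v - u))"
    unfolding affine_hull_2_alt ellipse_point_affine by auto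
  then have w: "w = u + t *\<^sub>R (v - u)" using ellipse_point_eq_iff[OF assms(1,2)] by simp
  then have "t * (1 - t) * (norm (v - u))\<^sup>2 = 0"
    using norm_chord_square[OF assms(3,4), of t] assms(5) by simp
  then have "t = 0 \<or> t = 1" using assms(6) by auto
  then show False using w assms(7,8) by auto
qed

text \<open>The scaled circle has semi-axes \<open>r / a\<close> and \<open>r / b\<close>, whence
  the two parameters. Real and imaginary parts are written through conjugates, and conjugates on the
  unit circle are inverses, so tangency becomes polynomial in \<open>u\<close> and
  \<open>v\<close>.\<close>

lemma line_tangent_ellipse_points:
  assumes "a > 0" "b > 0" "r > 0" "norm u = 1" "norm v = 1" "u \<noteq> v"
  shows "line_tangent (ellipse_point a b u) (ellipse_point a b v) (ellipse_point a b z) r \<longleftrightarrow>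
    chord_conic z (of_real (r\<^sup>2 / b\<^sup>2 - r\<^sup>2 / a\<^sup>2)) (of_real (r\<^sup>2 / a\<^sup>2 + r\<^sup>2 / b\<^sup>2)) u v = 0"
    (is "?tangent \<longleftrightarrow> chord_conic z ?k ?m u v = 0")
proof -
  define e A B \<rho> :: complex where "e = v - u" and "A = of_real a" and "B = of_real b" and "\<rho> = of_real r"
  have nz: "A \<noteq> 0" "B \<noteq> 0" "e \<noteq> 0" "u \<noteq> 0" "v \<noteq> 0"
    using assms by (auto simp: A_def B_def e_def)
  have uv: "u * cnj u = 1" "v * cnj v = 1"
    using assms by (simp_all add: complex_norm_square[symmetric])
  have ce: "cnj e = cnj v - cnj u" by (simp add: e_def)
  have "?tangent \<longleftrightarrow> (a * b * Im (cnj e * (u - z)))\<^sup>2 = r\<^sup>2 * ((a * Re e)\<^sup>2 + (b * Im e)\<^sup>2)"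
  proof -
    have "fst (ellipse_point a b v - ellipse_point a b u) * snd (ellipse_point a b u - ellipse_point a b z)
      - snd (ellipse_point a b v - ellipse_point a b u) * fst (ellipse_point a b u - ellipse_point a b z)
      = a * b * Im (cnj e * (u - z))"
      by (simp add: ellipse_point_def e_def algebra_simps)
    moreover have "(dist (ellipse_point a b u) (ellipse_point a b v))\<^sup>2 = (a * Re e)\<^sup>2 + (b * Im e)\<^sup>2"
      by (simp add: ellipse_point_def e_def dist_Pair_Pair dist_real_def power_mult_distrib
          power2_commute[of "Re u"] power2_commute[of "Im u"] flip: right_diff_distrib)
    ultimately show ?thesis
      using line_tangent_iff ellipse_point_eq_iff assms by simp
  qed
  also have "\<dots> \<longleftrightarrow> (A * B * of_real (Im (cnj e * (u - z))))\<^sup>2 =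
      \<rho>\<^sup>2 * ((A * of_real (Re e))\<^sup>2 + (B * of_real (Im e))\<^sup>2)"
    unfolding A_def B_def \<rho>_def
    by (simp only: of_real_eq_iff flip: of_real_mult of_real_power of_real_add)
  also have "\<dots> \<longleftrightarrow> A\<^sup>2 * B\<^sup>2 * (cnj e * (u - z) - e * (cnj u - cnj z))\<^sup>2 +
      \<rho>\<^sup>2 * (A\<^sup>2 * (e + cnj e)\<^sup>2 - B\<^sup>2 * (e - cnj e)\<^sup>2) = 0"
  proof -
    have re: "of_real (Re x) = (x + cnj x) / 2" for x :: complex
      by (simp add: complex_add_cnj)
    have im: "of_real (Im x) = - \<i> * (x - cnj x) / 2" for x :: complex
      by (simp add: complex_eq_iff)
    have "(A * B * (- \<i> * X / 2))\<^sup>2 - \<rho>\<^sup>2 * ((A * (Y / 2))\<^sup>2 + (B * (- \<i> * D / 2))\<^sup>2) =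
        - (A\<^sup>2 * B\<^sup>2 * X\<^sup>2 + \<rho>\<^sup>2 * (A\<^sup>2 * Y\<^sup>2 - B\<^sup>2 * D\<^sup>2)) / 4" for X Y D :: complex
      by (simp add: power_mult_distrib power_divide field_simps)
    then have "(A * B * (- \<i> * X / 2))\<^sup>2 = \<rho>\<^sup>2 * ((A * (Y / 2))\<^sup>2 + (B * (- \<i> * D / 2))\<^sup>2) \<longleftrightarrow>
        A\<^sup>2 * B\<^sup>2 * X\<^sup>2 + \<rho>\<^sup>2 * (A\<^sup>2 * Y\<^sup>2 - B\<^sup>2 * D\<^sup>2) = 0" for X Y D :: complex
      by (metis (no_types, opaque_lifting) add.inverse_neutral div_0 divide_eq_0_iff eq_iff_diff_eq_0
          neg_equal_0_iff_equal zero_neq_numeral)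
    then show ?thesis unfolding re im by simp
  qed
  \<comment> \<open>Multiplying by \<open>(u * v)\<^sup>2\<close> clears the conjugates of
    \<open>u\<close> and \<open>v\<close>; then the factor \<open>e\<^sup>2\<close>, which is
    nonzero for \<open>u \<noteq> v\<close>, splits off.\<close>
  also have "\<dots> \<longleftrightarrow> (u * v)\<^sup>2 * (A\<^sup>2 * B\<^sup>2 * (cnj e * (u - z) - e * (cnj u - cnj z))\<^sup>2 +
      \<rho>\<^sup>2 * (A\<^sup>2 * (e + cnj e)\<^sup>2 - B\<^sup>2 * (e - cnj e)\<^sup>2)) = 0"
    using nz by simp
  also have "(u * v)\<^sup>2 * (A\<^sup>2 * B\<^sup>2 * (cnj e * (u - z) - e * (cnj u - cnj z))\<^sup>2 +
      \<rho>\<^sup>2 * (A\<^sup>2 * (e + cnj e)\<^sup>2 - B\<^sup>2 * (e - cnj e)\<^sup>2)) =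
      e\<^sup>2 * (A\<^sup>2 * B\<^sup>2 * (z + u * v * cnj z - (u + v))\<^sup>2 +
      \<rho>\<^sup>2 * (A\<^sup>2 * (u * v - 1)\<^sup>2 - B\<^sup>2 * (u * v + 1)\<^sup>2))"
  proof -
    have "u * v * cnj e = - e" using uv unfolding ce unfolding e_def by algebra
    then have "u * v * (e + cnj e) = e * (u * v - 1)" "u * v * (e - cnj e) = e * (u * v + 1)"
      "u * v * (cnj e * (u - z) - e * (cnj u - cnj z)) = e * (z + u * v * cnj z - (u + v))"
      using uv by algebra+
    then show ?thesis by algebra
  qed
  also have "\<dots> = 0 \<longleftrightarrow> A\<^sup>2 * B\<^sup>2 * (z + u * v * cnj z - (u + v))\<^sup>2 +
      \<rho>\<^sup>2 * (A\<^sup>2 * (u * v - 1)\<^sup>2 - B\<^sup>2 * (u * v + 1)\<^sup>2) = 0"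
    using nz by simp
  also have "A\<^sup>2 * B\<^sup>2 * (z + u * v * cnj z - (u + v))\<^sup>2 +
      \<rho>\<^sup>2 * (A\<^sup>2 * (u * v - 1)\<^sup>2 - B\<^sup>2 * (u * v + 1)\<^sup>2) = A\<^sup>2 * B\<^sup>2 * chord_conic z ?k ?m u v"
  proof -
    have "?k = \<rho>\<^sup>2 / B\<^sup>2 - \<rho>\<^sup>2 / A\<^sup>2" "?m = \<rho>\<^sup>2 / A\<^sup>2 + \<rho>\<^sup>2 / B\<^sup>2"
      by (simp_all add: A_def B_def \<rho>_def)
    then have "A\<^sup>2 * B\<^sup>2 * ?k = \<rho>\<^sup>2 * (A\<^sup>2 - B\<^sup>2)" "A\<^sup>2 * B\<^sup>2 * ?m = \<rho>\<^sup>2 * (A\<^sup>2 + B\<^sup>2)"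
      using nz by (simp_all add: field_simps)
    then show ?thesis unfolding chord_conic_def by algebra
  qed
  also have "\<dots> = 0 \<longleftrightarrow> chord_conic z ?k ?m u v = 0"
    using nz by simp
  finally show ?thesis .
qed

section \<open>The circle as incircle\<close>

lemma touching_point_in_chord:
  assumes "a > 0" "b > 0" "norm u = 1" "norm v = 1"
    and "ellipse_point a b u + t *\<^sub>R (ellipse_point a b v - ellipse_point a b u) \<in> ellipse_interior a b"
  shows "0 < t" "t < 1"
proof -
  have "norm (u + t *\<^sub>R (v - u)) < 1"
    using assms(5) unfolding ellipse_point_affine ellipse_point_in_interior_iff[OF assms(1,2)] .
  then have "(norm (u + t *\<^sub>R (v - u)))\<^sup>2 < 1" by (simp add: abs_square_less_1)
  then have "0 < t * (1 - t) * (norm (v - u))\<^sup>2" using norm_chord_square[OF assms(3,4)] by simp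
  then have "0 < t * (1 - t)" by (simp add: zero_less_mult_iff)
  then show "0 < t" "t < 1" by (auto simp: zero_less_mult_iff)
qed

text \<open>The touching point lies in the disc, hence inside the ellipse, hence strictly between
  the endpoints of the chord; so the tangent lengths are positive and add up to the chord.\<close>

lemma chord_tangent_lengths:
  assumes "a > 0" "b > 0" "r > 0" "P \<in> ellipse a b" "Q \<in> ellipse a b" "P \<noteq> Q"
    and "cball C r \<subseteq> ellipse_interior a b" "line_tangent P Q C r"
  obtains x y where "x > 0" "y > 0" "dist P Q = x + y"
    "(dist C P)\<^sup>2 = r\<^sup>2 + x\<^sup>2" "(dist C Q)\<^sup>2 = r\<^sup>2 + y\<^sup>2"
proof -
  obtain u v where uv: "P = ellipse_point a b u" "Q = ellipse_point a b v"
    using ellipse_point_surj[OF assms(1,2)] by metis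
  then have n: "norm u = 1" "norm v = 1"
    using assms(4,5) ellipse_point_in_ellipse_iff[OF assms(1,2)] by auto
  obtain t where t: "dist C (P + t *\<^sub>R (Q - P)) = r"
      "(dist C P)\<^sup>2 = r\<^sup>2 + (t * dist P Q)\<^sup>2" "(dist C Q)\<^sup>2 = r\<^sup>2 + ((1 - t) * dist P Q)\<^sup>2"
    using line_tangent_touching_point[OF assms(6,3,8)] by blast
  then have "P + t *\<^sub>R (Q - P) \<in> ellipse_interior a b"
    using assms(7) by auto
  then have "0 < t" "t < 1" using touching_point_in_chord[OF assms(1,2) n] uv by auto
  then show thesis
    using that[of "t * dist P Q" "(1 - t) * dist P Q"] t assms(6) by (simp add: algebra_simps)
qed

lemma poncelet_incenter:
  assumes "a > 0" "b > 0" "r > 0" "cball C r \<subseteq> ellipse_interior a b"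
    and nc: "\<not> collinear {P, Q, R}" and "P \<in> ellipse a b" "Q \<in> ellipse a b" "R \<in> ellipse a b"
    and "line_tangent P Q C r" "line_tangent Q R C r" "line_tangent R P C r"
  shows "incenter P Q R = C"
proof -
  have ne: "P \<noteq> Q" "Q \<noteq> R" "R \<noteq> P" using nc by (auto simp: insert_commute)
  obtain x y where xy: "x > 0" "y > 0" "dist P Q = x + y"
    "(dist C P)\<^sup>2 = r\<^sup>2 + x\<^sup>2" "(dist C Q)\<^sup>2 = r\<^sup>2 + y\<^sup>2"
    using chord_tangent_lengths assms ne by metis
  obtain y' z where yz: "y' > 0" "z > 0" "dist Q R = y' + z"
    "(dist C Q)\<^sup>2 = r\<^sup>2 + y'\<^sup>2" "(dist C R)\<^sup>2 = r\<^sup>2 + z\<^sup>2"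
    using chord_tangent_lengths assms ne by metis
  obtain z' x' where zx: "z' > 0" "x' > 0" "dist R P = z' + x'"
    "(dist C R)\<^sup>2 = r\<^sup>2 + z'\<^sup>2" "(dist C P)\<^sup>2 = r\<^sup>2 + x'\<^sup>2"
    using chord_tangent_lengths assms ne by metis
  \<comment> \<open>The two tangents from a vertex are equally long.\<close>
  have "y' = y" "z' = z" "x' = x"
    using xy yz zx by (auto simp: power2_eq_iff_nonneg)
  then show ?thesis using incenter_eqI[OF nc] xy yz zx by metis
qed

text \<open>The right-hand side is symmetric in \<open>u\<close>, \<open>v\<close>,
  \<open>w\<close>, so \<open>(zx, zy)\<close> is equidistant from the three points. For
  \<open>a\<^sup>2 \<noteq> b\<^sup>2\<close>, \<open>cnj s3\<close> is the parameter of the fourth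
  point of their circle on the ellipse, as the parameters of four concyclic points have product
  1.\<close>

lemma dist_circumcenter_ellipse:
  assumes "a \<noteq> 0" "b \<noteq> 0" "norm u = 1" "norm v = 1" "norm w = 1"
  defines "s1 \<equiv> u + v + w" and "s2 \<equiv> u * v + v * w + w * u" and "s3 \<equiv> u * v * w"
  defines "zx \<equiv> (a\<^sup>2 - b\<^sup>2) / (4 * a) * Re (s1 + s3)" and "zy \<equiv> - (a\<^sup>2 - b\<^sup>2) / (4 * b) * Im (s1 - s3)"
  shows "(dist (zx, zy) (ellipse_point a b u))\<^sup>2 =
    zx\<^sup>2 + zy\<^sup>2 - ((a\<^sup>2 - b\<^sup>2) / 2 * Re s2 - (a\<^sup>2 + b\<^sup>2) / 2)"
proof -
  have unit: "u * cnj u = 1" "v * cnj v = 1" "w * cnj w = 1"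
    using assms(3-5) by (simp_all add: complex_norm_square[symmetric])
  \<comment> \<open>By Vieta \<open>u\<^sup>2 - s1 * u + s2 = v * w\<close>, so the expression added
    to its conjugate is \<open>v * w - cnj (v * w)\<close>, purely imaginary.\<close>
  have "u\<^sup>2 - (s1 + cnj s3) * u + s2 + cnj (u\<^sup>2 - (s1 + cnj s3) * u + s2) = 0"
  proof -
    have "cnj s3 * u = cnj v * cnj w" "s3 * cnj u = v * w"
      using unit(1) unfolding s3_def complex_cnj_mult by algebra+
    then show ?thesis
      unfolding s1_def s2_def complex_cnj_mult complex_cnj_add complex_cnj_diff complex_cnj_power
        complex_cnj_cnj
      by algebra
  qed
  then have "Re (u\<^sup>2 - (s1 + cnj s3) * u + s2) = 0"
    by (simp only: complex_add_cnj of_real_eq_0_iff mult_eq_0_iff) simp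
  then have re: "(Re u)\<^sup>2 - (Im u)\<^sup>2 - (Re (s1 + s3) * Re u - Im (s1 - s3) * Im u) + Re s2 = 0"
    by (simp add: power2_eq_square algebra_simps)
  have n: "(Re u)\<^sup>2 + (Im u)\<^sup>2 = 1" using assms(3) by (simp add: cmod_power2[symmetric])
  have "2 * a * zx = (a\<^sup>2 - b\<^sup>2) / 2 * Re (s1 + s3)" "2 * b * zy = - (a\<^sup>2 - b\<^sup>2) / 2 * Im (s1 - s3)"
    using assms(1,2) unfolding zx_def zy_def by simp_all
  moreover have "(dist (zx, zy) (ellipse_point a b u))\<^sup>2 =
      zx\<^sup>2 + zy\<^sup>2 - (2 * a * zx) * Re u - (2 * b * zy) * Im u + a\<^sup>2 * (Re u)\<^sup>2 + b\<^sup>2 * (Im u)\<^sup>2"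
  proof -
    have "(dist (zx, zy) (ellipse_point a b u))\<^sup>2 = (zx - a * Re u)\<^sup>2 + (zy - b * Im u)\<^sup>2"
      by (simp add: ellipse_point_def dist_Pair_Pair dist_real_def)
    then show ?thesis by (simp add: power2_diff power_mult_distrib)
  qed
  ultimately show ?thesis
    using re n by algebra
qed

text \<open>Stereographic projection from 1; the preimage of \<open>t\<close> is
  \<open>(t + \<i>) / (t - \<i>)\<close>.\<close>

lemma Im_over_one_minus_Re_onto:
  obtains \<mu> :: complex where "norm \<mu> = 1" "\<mu> \<noteq> 1" "Im \<mu> / (1 - Re \<mu>) = t"
proof -
  have pos: "t\<^sup>2 + 1 > 0" by (simp add: add_nonneg_pos)
  define \<mu> where "\<mu> = Complex ((t\<^sup>2 - 1) / (t\<^sup>2 + 1)) (2 * t / (t\<^sup>2 + 1))"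
  have "(norm \<mu>)\<^sup>2 = ((t\<^sup>2 - 1)\<^sup>2 + (2 * t)\<^sup>2) / (t\<^sup>2 + 1)\<^sup>2"
    by (simp add: \<mu>_def cmod_power2 power_divide add_divide_distrib)
  also have "(t\<^sup>2 - 1)\<^sup>2 + (2 * t)\<^sup>2 = (t\<^sup>2 + 1)\<^sup>2" by algebra
  finally have "norm \<mu> = 1" using pos by (simp add: power2_eq_1_iff) (use norm_ge_zero[of \<mu>] in linarith)
  moreover have "1 - Re \<mu> = 2 / (t\<^sup>2 + 1)" using pos by (simp add: \<mu>_def field_simps)
  moreover have "Im \<mu> = 2 * t / (t\<^sup>2 + 1)" by (simp add: \<mu>_def)
  ultimately show thesis using pos by (intro that[of \<mu>]) auto
qed

subsection \<open>Families centered on the locus of equilateral centroids\<close>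

locale equilateral_center =
  fixes a b X Y :: real
  assumes b_less_a: "b < a" and b_pos: "0 < b"
    and on_ellipse: "((a\<^sup>2 + 3 * b\<^sup>2) * X)\<^sup>2 + ((3 * a\<^sup>2 + b\<^sup>2) * Y)\<^sup>2 = 1"
begin

text \<open>Here \<open>X = x\<^sub>c / (a c\<^sup>2)\<close> and \<open>Y = y\<^sub>c / (b c\<^sup>2)\<close>; \<open>z\<close> is the scaled center, and \<open>\<omega>\<close> the product of
  the scaled vertices of the equilateral triangle.\<close>

definition z :: complex where "z = Complex ((a\<^sup>2 - b\<^sup>2) * X) ((a\<^sup>2 - b\<^sup>2) * Y)"
definition \<omega> :: complex where "\<omega> = Complex ((a\<^sup>2 + 3 * b\<^sup>2) * X) ((3 * a\<^sup>2 + b\<^sup>2) * Y)"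
text \<open>The squared radius, the gap \<open>1 - |z|^2\<close> and the focal parameter are all
  multiples of \<open>h\<close>. The equilateral triangle of the family has circumradius
  \<open>4 * a * b * sqrt h\<close>, of which \<open>radius\<close> is half.\<close>

definition h :: real where "h = b\<^sup>2 * X\<^sup>2 + a\<^sup>2 * Y\<^sup>2"
definition radius :: real where "radius = 2 * a * b * sqrt h"

lemma a_pos: "0 < a" using b_less_a b_pos by simp

lemma diff_pos: "0 < a\<^sup>2 - b\<^sup>2" using b_less_a b_pos by (simp add: power_strict_mono)

lemma h_pos: "0 < h"
proof -
  have "X \<noteq> 0 \<or> Y \<noteq> 0" using on_ellipse by auto
  then show ?thesis using a_pos b_pos
    by (auto simp: h_def intro: add_pos_nonneg add_nonneg_pos)
qed

lemma radius_pos: "0 < radius" using a_pos b_pos h_pos by (simp add: radius_def)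

lemma radius_square: "radius\<^sup>2 = 4 * a\<^sup>2 * b\<^sup>2 * h"
  using h_pos by (simp add: radius_def power_mult_distrib)

lemma norm_\<omega>: "norm \<omega> = 1"
  using on_ellipse by (simp add: \<omega>_def complex_norm)

lemma \<omega>_cnj: "\<omega> * cnj \<omega> = 1"
  using norm_\<omega> by (simp add: complex_norm_square[symmetric])

lemma one_minus_norm_z: "1 - (norm z)\<^sup>2 = 8 * (a\<^sup>2 + b\<^sup>2) * h"
  unfolding cmod_power2 z_def h_def using on_ellipse by simp algebra

lemma z_nonzero: "z \<noteq> 0"
  using on_ellipse diff_pos by (auto simp: z_def complex_eq_iff)

text \<open>The left-hand side is the product of the foci of the scaled circle.\<close>

lemma focal_product: "cnj z * \<omega> = z\<^sup>2 + of_real (4 * (a\<^sup>2 - b\<^sup>2) * h)"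
  unfolding complex_eq_iff z_def \<omega>_def h_def
  by (simp add: power2_eq_square algebra_simps)

lemma radius_quotients:
  "radius\<^sup>2 / b\<^sup>2 - radius\<^sup>2 / a\<^sup>2 = 4 * (a\<^sup>2 - b\<^sup>2) * h"
  "radius\<^sup>2 / a\<^sup>2 + radius\<^sup>2 / b\<^sup>2 = 4 * (a\<^sup>2 + b\<^sup>2) * h"
  unfolding radius_square using a_pos b_pos by (simp_all add: field_simps)

text \<open>The condition on the radius for Poncelet triangles to close up.\<close>

lemma poncelet_condition:
  "1 + (cnj z * \<omega>) * cnj (cnj z * \<omega>) = 2 * (z * cnj z + of_real (4 * (a\<^sup>2 + b\<^sup>2) * h))"
proof -
  \<comment> \<open>As \<open>\<omega>\<close> is unimodular, the focal product has modulus
    \<open>|z|\<close>, and the condition reduces to \<open>one_minus_norm_z\<close>.\<close>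
  have "z * cnj z = of_real (1 - 8 * (a\<^sup>2 + b\<^sup>2) * h)"
  proof -
    have "(norm z)\<^sup>2 = 1 - 8 * (a\<^sup>2 + b\<^sup>2) * h" using one_minus_norm_z by linarith
    then show ?thesis by (simp only: complex_norm_square[symmetric])
  qed
  then have "1 = z * cnj z + 2 * of_real (4 * (a\<^sup>2 + b\<^sup>2) * h)" by simp
  moreover have "(cnj z * \<omega>) * cnj (cnj z * \<omega>) = z * cnj z"
    using \<omega>_cnj unfolding complex_cnj_mult complex_cnj_cnj by algebra
  ultimately show ?thesis by algebra
qed

text \<open>An S-procedure certificate: \<open>1 - x\<^sup>2 / a\<^sup>2 - y\<^sup>2 / b\<^sup>2 - \<tau> (radius\<^sup>2 - |(x, y) - C|\<^sup>2)\<close> is positive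
  everywhere for the multiplier \<open>\<tau> = (3 a\<^sup>2 - b\<^sup>2) / (2 a\<^sup>2 b\<^sup>2)\<close>.\<close>

lemma incircle_inside: "cball (ellipse_point a b z) radius \<subseteq> ellipse_interior a b"
proof
  fix P assume P: "P \<in> cball (ellipse_point a b z) radius"
  obtain p where p: "P = ellipse_point a b p" using ellipse_point_surj[OF a_pos b_pos] .
  define x y where "x = Re p" and "y = Im p"
  have "(dist (ellipse_point a b z) P)\<^sup>2 \<le> radius\<^sup>2"
    using P by (intro power_mono) auto
  then have le: "a\<^sup>2 * (x - (a\<^sup>2 - b\<^sup>2) * X)\<^sup>2 + b\<^sup>2 * (y - (a\<^sup>2 - b\<^sup>2) * Y)\<^sup>2 \<le> 4 * a\<^sup>2 * b\<^sup>2 * h"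
    unfolding p radius_square ellipse_point_def dist_Pair_Pair dist_real_def z_def x_def y_def
    by (simp add: power_mult_distrib power2_commute flip: right_diff_distrib)
  define s where "s = 3 * a\<^sup>2 - b\<^sup>2"
  have s: "s > 0" unfolding s_def using diff_pos zero_le_power2[of a] by linarith
  \<comment> \<open>What the multiplier leaves over is a quadratic with positive leading
    coefficients; completing the squares in \<open>x\<close> and \<open>y\<close> leaves a positive
    constant.\<close>
  have id: "6 * a\<^sup>2 * b\<^sup>2 * (1 - (x\<^sup>2 + y\<^sup>2)) =
      3 * s * (4 * a\<^sup>2 * b\<^sup>2 * h - (a\<^sup>2 * (x - (a\<^sup>2 - b\<^sup>2) * X)\<^sup>2 + b\<^sup>2 * (y - (a\<^sup>2 - b\<^sup>2) * Y)\<^sup>2))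
      + (a\<^sup>2 * (a\<^sup>2 - b\<^sup>2) * (3 * x - s * X)\<^sup>2 + 3 * b\<^sup>2 * (a\<^sup>2 - b\<^sup>2) * (y - s * Y)\<^sup>2)
      + 8 * a\<^sup>2 * b^4 * ((a\<^sup>2 - b\<^sup>2) * X\<^sup>2 + 9 * h)"
    using on_ellipse unfolding s_def h_def by algebra
  have "0 \<le> 3 * s * (4 * a\<^sup>2 * b\<^sup>2 * h - (a\<^sup>2 * (x - (a\<^sup>2 - b\<^sup>2) * X)\<^sup>2 + b\<^sup>2 * (y - (a\<^sup>2 - b\<^sup>2) * Y)\<^sup>2))"
    using le s by simp
  moreover have "0 \<le> a\<^sup>2 * (a\<^sup>2 - b\<^sup>2) * (3 * x - s * X)\<^sup>2 + 3 * b\<^sup>2 * (a\<^sup>2 - b\<^sup>2) * (y - s * Y)\<^sup>2"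
    using diff_pos by simp
  moreover have "0 < 8 * a\<^sup>2 * b^4 * ((a\<^sup>2 - b\<^sup>2) * X\<^sup>2 + 9 * h)"
    using a_pos b_pos h_pos b_less_a by (intro mult_pos_pos add_nonneg_pos mult_nonneg_nonneg) auto
  ultimately have "0 < 6 * a\<^sup>2 * b\<^sup>2 * (1 - (x\<^sup>2 + y\<^sup>2))" unfolding id by linarith
  then have "0 < 1 - (x\<^sup>2 + y\<^sup>2)"
    by (rule zero_less_mult_pos) (use a_pos b_pos in simp)
  then have "(norm p)\<^sup>2 < 1" by (simp add: cmod_power2 x_def y_def)
  then show "P \<in> ellipse_interior a b"
    unfolding p ellipse_point_in_interior_iff[OF a_pos b_pos] by (simp add: abs_square_less_1)
qed

text \<open>The condition that Poncelet triangles close up is quadratic in \<open>r\<^sup>2\<close>; the product of its roots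
  is too large for both circles to lie inside the ellipse.\<close>

lemma incircle_unique:
  assumes "r > 0" "cball (ellipse_point a b z) r \<subseteq> ellipse_interior a b"
  defines "q \<equiv> z\<^sup>2 + of_real (r\<^sup>2 / b\<^sup>2 - r\<^sup>2 / a\<^sup>2)"
  assumes "1 + q * cnj q = 2 * (z * cnj z + of_real (r\<^sup>2 / a\<^sup>2 + r\<^sup>2 / b\<^sup>2))"
  shows "r = radius"
proof -
  define N where "N = (norm z)\<^sup>2"
  have N: "0 < 1 - N" unfolding N_def one_minus_norm_z using h_pos a_pos
    by (simp add: add_pos_nonneg del: distrib_left_numeral)
  have r2: "r\<^sup>2 < b\<^sup>2 * (1 - N)"
  proof -
    \<comment> \<open>The highest and the lowest point of the circle lie inside the ellipse; adding
      their two bounds cancels the term linear in \<open>r\<close>.\<close>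
    have "(norm (Complex (Re z) (Im z + s / b)))\<^sup>2 < 1" if "\<bar>s\<bar> = r" for s
    proof -
      have "ellipse_point a b (Complex (Re z) (Im z + s / b)) \<in> cball (ellipse_point a b z) r"
        using that b_pos by (simp add: ellipse_point_def dist_Pair_Pair dist_real_def algebra_simps)
      then have "norm (Complex (Re z) (Im z + s / b)) < 1"
        using assms(2) ellipse_point_in_interior_iff[OF a_pos b_pos] by blast
      then show ?thesis by (simp add: abs_square_less_1)
    qed
    from this[of r] this[of "- r"] assms(1)
    have "N + (r / b)\<^sup>2 < 1" unfolding N_def cmod_power2 by (simp add: power2_eq_square algebra_simps)
    then show ?thesis using b_pos by (simp add: power_divide field_simps)
  qed
  have R2: "radius\<^sup>2 < b\<^sup>2 * (1 - N)"
  proof -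
    have "4 * a\<^sup>2 * b\<^sup>2 * h < 8 * a\<^sup>2 * b\<^sup>2 * h + 8 * b^4 * h" using h_pos a_pos b_pos by (simp add: add_pos_pos)
    then show ?thesis unfolding radius_square N_def one_minus_norm_z
      by (simp add: power2_eq_square power4_eq_xxxx algebra_simps)
  qed
  define \<kappa> m \<zeta> where "\<kappa> = (a\<^sup>2 - b\<^sup>2) / (a\<^sup>2 * b\<^sup>2)" and "m = (a\<^sup>2 + b\<^sup>2) / (a\<^sup>2 * b\<^sup>2)" and "\<zeta> = Re (z\<^sup>2)"
  have km: "s\<^sup>2 / b\<^sup>2 - s\<^sup>2 / a\<^sup>2 = \<kappa> * s\<^sup>2" "s\<^sup>2 / a\<^sup>2 + s\<^sup>2 / b\<^sup>2 = m * s\<^sup>2" for s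
    using a_pos b_pos by (simp_all add: \<kappa>_def m_def field_simps)
  have quad: "\<kappa>\<^sup>2 * (s\<^sup>2)\<^sup>2 + 2 * (\<kappa> * \<zeta> - m) * s\<^sup>2 + (1 - N)\<^sup>2 = 0"
    if "1 + (z\<^sup>2 + of_real (s\<^sup>2 / b\<^sup>2 - s\<^sup>2 / a\<^sup>2)) * cnj (z\<^sup>2 + of_real (s\<^sup>2 / b\<^sup>2 - s\<^sup>2 / a\<^sup>2)) =
      2 * (z * cnj z + of_real (s\<^sup>2 / a\<^sup>2 + s\<^sup>2 / b\<^sup>2))" for s
  proof -
    have "complex_of_real (1 + (norm (z\<^sup>2 + of_real (\<kappa> * s\<^sup>2)))\<^sup>2) = of_real (2 * (N + m * s\<^sup>2))"
      using that unfolding km N_def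
      by (simp only: of_real_add of_real_mult complex_norm_square of_real_1 of_real_numeral)
    then have "1 + (norm (z\<^sup>2 + of_real (\<kappa> * s\<^sup>2)))\<^sup>2 = 2 * (N + m * s\<^sup>2)"
      by (simp only: of_real_eq_iff)
    moreover have "(norm (z\<^sup>2 + of_real (\<kappa> * s\<^sup>2)))\<^sup>2 = (norm (z\<^sup>2))\<^sup>2 + 2 * \<kappa> * s\<^sup>2 * \<zeta> + (\<kappa> * s\<^sup>2)\<^sup>2"
      unfolding cmod_power2 \<zeta>_def by (simp add: power2_eq_square algebra_simps)
    moreover have "(norm (z\<^sup>2))\<^sup>2 = N\<^sup>2" by (simp add: N_def norm_power)
    ultimately show ?thesis by algebra
  qed
  have q1: "\<kappa>\<^sup>2 * (r\<^sup>2)\<^sup>2 + 2 * (\<kappa> * \<zeta> - m) * r\<^sup>2 + (1 - N)\<^sup>2 = 0"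
    using quad assms(4) unfolding q_def by blast
  have q2: "\<kappa>\<^sup>2 * (radius\<^sup>2)\<^sup>2 + 2 * (\<kappa> * \<zeta> - m) * radius\<^sup>2 + (1 - N)\<^sup>2 = 0"
    using quad[of radius] poncelet_condition unfolding radius_quotients focal_product by blast
  have "r\<^sup>2 = radius\<^sup>2"
  proof (rule ccontr)
    assume "r\<^sup>2 \<noteq> radius\<^sup>2"
    \<comment> \<open>Eliminating the linear coefficient from \<open>q1\<close> and
      \<open>q2\<close>: two distinct roots have product
      \<open>(1 - N)\<^sup>2 / \<kappa>\<^sup>2\<close>. This contradicts the bounds
      \<open>r2\<close> and \<open>R2\<close>, because \<open>\<kappa> * b\<^sup>2\<close> is at
      most 1.\<close>
    moreover have "(r\<^sup>2 - radius\<^sup>2) * ((1 - N)\<^sup>2 - \<kappa>\<^sup>2 * (r\<^sup>2 * radius\<^sup>2)) = 0"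
      using q1 q2 by algebra
    ultimately have eq: "(1 - N)\<^sup>2 = \<kappa>\<^sup>2 * (r\<^sup>2 * radius\<^sup>2)" by simp
    have "r\<^sup>2 * radius\<^sup>2 < (b\<^sup>2 * (1 - N)) * (b\<^sup>2 * (1 - N))"
      using r2 R2 by (intro mult_strict_mono') auto
    moreover have "0 < \<kappa>\<^sup>2" using b_less_a b_pos by (simp add: \<kappa>_def)
    ultimately have "(1 - N)\<^sup>2 < \<kappa>\<^sup>2 * ((b\<^sup>2 * (1 - N)) * (b\<^sup>2 * (1 - N)))" unfolding eq by simp
    also have "\<dots> = (\<kappa> * b\<^sup>2)\<^sup>2 * (1 - N)\<^sup>2" by algebra
    also have "\<dots> \<le> 1 * (1 - N)\<^sup>2"
    proof (rule mult_right_mono)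
      have "\<kappa> * b\<^sup>2 = 1 - b\<^sup>2 / a\<^sup>2" using a_pos b_pos by (simp add: \<kappa>_def field_simps)
      moreover have "0 \<le> 1 - b\<^sup>2 / a\<^sup>2" "1 - b\<^sup>2 / a\<^sup>2 \<le> 1" using diff_pos a_pos by (simp_all add: field_simps)
      ultimately show "(\<kappa> * b\<^sup>2)\<^sup>2 \<le> 1" by (simp add: power_le_one)
    qed simp
    finally show False by simp
  qed
  then show ?thesis using assms(1) radius_pos by (simp add: power2_eq_iff_nonneg)
qed

text \<open>The parameter \<open>\<mu>\<close> is normalized so that \<open>\<mu> = 1\<close> belongs to the equilateral triangle.\<close>

definition vieta :: "complex \<Rightarrow> complex \<Rightarrow> complex \<Rightarrow> complex \<Rightarrow> bool" where
  "vieta \<mu> u v w \<longleftrightarrow> u + v + w = z * (2 + \<mu>) \<and> u * v + v * w + w * u = cnj z * \<omega> * (1 + 2 * \<mu>)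
     \<and> u * v * w = \<omega> * \<mu>"

text \<open>The required symmetric functions are those of the Blaschke equation with foci
  \<open>f\<close>, \<open>g\<close> and value \<open>\<omega> * \<mu>\<close>, whose roots are
  unimodular and distinct once the foci lie in the unit disc.\<close>

lemma vieta_triangle_exists:
  assumes "norm \<mu> = 1"
  obtains u v w where "vieta \<mu> u v w" "norm u = 1" "norm v = 1" "norm w = 1" "u \<noteq> v" "v \<noteq> w" "w \<noteq> u"
proof -
  \<comment> \<open>The longer semi-axis of the scaled circle is vertical, so its foci are
    \<open>z\<close> moved up and down by \<open>t\<close>.\<close>
  define t where "t = 2 * sqrt ((a\<^sup>2 - b\<^sup>2) * h)"
  define f g where "f = z + \<i> * of_real t" and "g = z - \<i> * of_real t"
  define l where "l = \<omega> * \<mu>"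
  have l: "norm l = 1" using assms norm_\<omega> by (simp add: l_def norm_mult)
  have t: "0 \<le> t" "t\<^sup>2 = 4 * ((a\<^sup>2 - b\<^sup>2) * h)" using diff_pos h_pos by (simp_all add: t_def power_mult_distrib)
  \<comment> \<open>Unscaled, the foci have distance \<open>b * t\<close> from the center, so they
    lie in the disc and thereby inside the ellipse.\<close>
  have "(b * t)\<^sup>2 \<le> radius\<^sup>2"
  proof -
    have "(b * t)\<^sup>2 = radius\<^sup>2 - 4 * (b\<^sup>2 * b\<^sup>2 * h)"
      unfolding radius_square power_mult_distrib t by algebra
    then show ?thesis using h_pos by simp
  qed
  then have bt: "b * t \<le> radius" by (rule power2_le_imp_le) (use radius_pos in simp)
  have foci: "norm (z + \<i> * of_real s) < 1" if "\<bar>s\<bar> = t" for s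
  proof -
    have "\<bar>b * s\<bar> \<le> radius" using bt that b_pos by (simp add: abs_mult)
    moreover have "dist (ellipse_point a b z) (ellipse_point a b (z + \<i> * of_real s)) = \<bar>b * s\<bar>"
      by (simp add: ellipse_point_def dist_Pair_Pair dist_real_def real_sqrt_mult abs_mult algebra_simps)
    ultimately have "ellipse_point a b (z + \<i> * of_real s) \<in> cball (ellipse_point a b z) radius" by simp
    then show ?thesis
      using incircle_inside ellipse_point_in_interior_iff[OF a_pos b_pos] by blast
  qed
  have f: "norm f < 1" and g: "norm g < 1"
    using foci[of t] foci[of "- t"] t(1) by (simp_all add: f_def g_def)
  have fg: "f + g = 2 * z" "f * g = cnj z * \<omega>"
  proof -
    have "f * g = z\<^sup>2 + of_real (t\<^sup>2)" by (simp add: f_def g_def power2_eq_square algebra_simps)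
    then show "f * g = cnj z * \<omega>" unfolding focal_product t by (simp add: algebra_simps)
  qed (simp add: f_def g_def)
  have cfg: "cnj f + cnj g = 2 * cnj z" "cnj f * cnj g = z * cnj \<omega>"
    using arg_cong[OF fg(1), of cnj] arg_cong[OF fg(2), of cnj] by simp_all
  obtain u v w where s: "u + v + w = f + g + l * (cnj f * cnj g)"
    "u * v + v * w + w * u = f * g + l * (cnj f + cnj g)" "u * v * w = l"
    using cubic_splits .
  have circle: "norm x = 1" if "x \<in> {u, v, w}" for x
  proof (rule blaschke_root_on_circle[OF f g l])
    have "(x - u) * (x - v) * (x - w) = 0" using that by auto
    then show "x * (x - f) * (x - g) = l * ((1 - cnj f * x) * (1 - cnj g * x))"
      using s by algebra
  qed
  have "u \<noteq> v" "v \<noteq> w" "w \<noteq> u"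
    using blaschke_root_simple[OF f g circle l, of u w] blaschke_root_simple[OF f g circle l, of v u]
      blaschke_root_simple[OF f g circle l, of w v] s by (auto simp: algebra_simps)
  moreover have "vieta \<mu> u v w"
  proof -
    have "l * (z * cnj \<omega>) = \<mu> * z" unfolding l_def using \<omega>_cnj by algebra
    then show ?thesis
      using s unfolding vieta_def fg cfg by (auto simp: l_def algebra_simps)
  qed
  ultimately show thesis using that circle by blast
qed

section \<open>Members of the family and their incenter\<close>

definition center :: "real \<times> real" where "center = ellipse_point a b z"

text \<open>A member satisfies the closing condition for its own radius, which forces that radius to
  be \<open>radius\<close>; the focal product is then \<open>cnj z * \<omega>\<close>, and only the
  product of the vertices stays free. Conversely, the circle of that radius touches all
  sides.\<close>

lemma poncelet_family_iff:
  "(P, Q, R) \<in> poncelet_family a b center \<longleftrightarrow>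
    (\<exists>\<mu> u v w. norm \<mu> = 1 \<and> vieta \<mu> u v w \<and> norm u = 1 \<and> norm v = 1 \<and> norm w = 1 \<and>
      u \<noteq> v \<and> v \<noteq> w \<and> w \<noteq> u \<and>
      P = ellipse_point a b u \<and> Q = ellipse_point a b v \<and> R = ellipse_point a b w)"
  (is "?lhs \<longleftrightarrow> ?rhs")
proof
  assume ?lhs
  then obtain r where nc: "\<not> collinear {P, Q, R}" and r: "r > 0" "cball center r \<subseteq> ellipse_interior a b"
    and on: "P \<in> ellipse a b" "Q \<in> ellipse a b" "R \<in> ellipse a b"
    and tan: "line_tangent P Q center r" "line_tangent Q R center r" "line_tangent R P center r"
    by (auto simp: poncelet_family_def)
  obtain u v w where uvw: "P = ellipse_point a b u" "Q = ellipse_point a b v" "R = ellipse_point a b w"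
    using ellipse_point_surj[OF a_pos b_pos] by metis
  have n: "norm u = 1" "norm v = 1" "norm w = 1"
    using on uvw ellipse_point_in_ellipse_iff[OF a_pos b_pos] by auto
  have ne: "u \<noteq> v" "v \<noteq> w" "w \<noteq> u" using nc unfolding uvw by (auto simp: insert_commute)
  have nz: "u \<noteq> 0" "v \<noteq> 0" "w \<noteq> 0" using n by auto
  note conic = tan[unfolded uvw center_def line_tangent_ellipse_points[OF a_pos b_pos r(1) n(1,2) ne(1)]
    line_tangent_ellipse_points[OF a_pos b_pos r(1) n(2,3) ne(2)]
    line_tangent_ellipse_points[OF a_pos b_pos r(1) n(3,1) ne(3)]]
  note T = chord_conic_triangle_converse[OF complex_cnj_complex_of_real refl nz ne conic]
  have "r = radius" using incircle_unique[OF r(1)] r(2) T(3) unfolding center_def by blast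
  note T = T(1,2)[unfolded \<open>r = radius\<close> radius_quotients focal_product[symmetric]]
  define \<mu> where "\<mu> = cnj \<omega> * (u * v * w)"
  have l: "u * v * w = \<omega> * \<mu>" unfolding \<mu>_def using \<omega>_cnj by algebra
  have "norm \<mu> = 1" using n norm_\<omega> by (simp add: \<mu>_def norm_mult)
  moreover have "vieta \<mu> u v w"
  proof -
    have "\<omega> * \<mu> * cnj (cnj z * \<omega>) = z * \<mu>" using \<omega>_cnj unfolding complex_cnj_mult complex_cnj_cnj by algebra
    then show ?thesis using T unfolding vieta_def l by (simp add: algebra_simps)
  qed
  ultimately show ?rhs using n ne uvw by blast
next
  assume ?rhs
  then obtain \<mu> u v w where vi: "vieta \<mu> u v w" and n: "norm u = 1" "norm v = 1" "norm w = 1"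
    and ne: "u \<noteq> v" "v \<noteq> w" "w \<noteq> u"
    and PQR: "P = ellipse_point a b u" "Q = ellipse_point a b v" "R = ellipse_point a b w"
    by blast
  have nz: "u \<noteq> 0" "v \<noteq> 0" "w \<noteq> 0" using n by auto
  have conic: "chord_conic z (of_real (radius\<^sup>2 / b\<^sup>2 - radius\<^sup>2 / a\<^sup>2))
      (of_real (radius\<^sup>2 / a\<^sup>2 + radius\<^sup>2 / b\<^sup>2)) x y = 0"
    if "t \<noteq> 0" "vieta \<mu> x y t" for x y t
  proof -
    have "\<omega> * \<mu> * cnj (cnj z * \<omega>) = z * \<mu>" using \<omega>_cnj unfolding complex_cnj_mult complex_cnj_cnj by algebra
    then have "x + y + t = 2 * z + x * y * t * cnj (cnj z * \<omega>)"
      "x * y + y * t + t * x = cnj z * \<omega> + 2 * (x * y * t) * cnj z"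
      using that(2) unfolding vieta_def by (auto simp: algebra_simps)
    then show ?thesis
      unfolding radius_quotients
      using chord_conic_triangle[OF complex_cnj_complex_of_real focal_product poncelet_condition that(1)]
      by blast
  qed
  have "vieta \<mu> v w u" "vieta \<mu> w u v" using vi by (auto simp: vieta_def algebra_simps)
  then have "line_tangent P Q center radius" "line_tangent Q R center radius" "line_tangent R P center radius"
    unfolding PQR center_def using line_tangent_ellipse_points[OF a_pos b_pos radius_pos] n ne conic vi nz
    by blast+
  then show ?lhs
    unfolding poncelet_family_def
    using ellipse_points_noncollinear[OF a_pos b_pos n ne] ellipse_point_in_ellipse_iff[OF a_pos b_pos]
      n radius_pos incircle_inside PQR by (auto simp: center_def)
qed

lemma incenter_eq_center:
  assumes "(P, Q, R) \<in> poncelet_family a b center"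
  shows "incenter P Q R = center"
proof -
  obtain r where "r > 0" "cball center r \<subseteq> ellipse_interior a b"
    "\<not> collinear {P, Q, R}" "P \<in> ellipse a b" "Q \<in> ellipse a b" "R \<in> ellipse a b"
    "line_tangent P Q center r" "line_tangent Q R center r" "line_tangent R P center r"
    using assms unfolding poncelet_family_def by auto
  then show ?thesis by (rule poncelet_incenter[OF a_pos b_pos])
qed

text \<open>\<open>t\<close> stands for the cotangent of half the argument of \<open>\<mu>\<close>.
  The point moves in direction \<open>(a * Y, - b * X)\<close>, orthogonal to the normal
  \<open>(b * X, a * Y)\<close> of the line.\<close>

definition X36_at :: "real \<Rightarrow> real \<times> real" where
  "X36_at t = center + (4 * a * b / (a\<^sup>2 - b\<^sup>2)) *\<^sub>R
     (b * ((a\<^sup>2 + b\<^sup>2) * X + 2 * a\<^sup>2 * Y * t), a * ((a\<^sup>2 + b\<^sup>2) * Y - 2 * b\<^sup>2 * X * t))"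

lemma center_eq: "center = (a * ((a\<^sup>2 - b\<^sup>2) * X), b * ((a\<^sup>2 - b\<^sup>2) * Y))"
  by (simp add: center_def ellipse_point_def z_def)

section \<open>Circumcircle and \<open>X36\<close> of a single triangle\<close>

context
  fixes \<mu> u v w :: complex and P Q R :: "real \<times> real"
  assumes \<mu>: "norm \<mu> = 1" and vieta: "vieta \<mu> u v w"
    and n: "norm u = 1" "norm v = 1" "norm w = 1" and ne: "u \<noteq> v" "v \<noteq> w" "w \<noteq> u"
    and PQR: "P = ellipse_point a b u" "Q = ellipse_point a b v" "R = ellipse_point a b w"
begin

lemma noncollinear_PQR: "\<not> collinear {P, Q, R}"
  unfolding PQR by (rule ellipse_points_noncollinear[OF a_pos b_pos n ne])

lemma in_family: "(P, Q, R) \<in> poncelet_family a b center"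
  unfolding poncelet_family_iff using \<mu> vieta n ne PQR by blast

text \<open>\<open>(dx, dy)\<close> is the vector from the incenter to the circumcenter, and \<open>incenter_power\<close> is
  \<open>R\<^sup>2 - dx\<^sup>2 - dy\<^sup>2 = 2 R r\<close>.\<close>

definition dx :: real where
  "dx = - (a\<^sup>2 - b\<^sup>2) / (2 * a) * ((a\<^sup>2 + b\<^sup>2) * X * (1 - Re \<mu>) + 2 * a\<^sup>2 * Y * Im \<mu>)"
definition dy :: real where
  "dy = - (a\<^sup>2 - b\<^sup>2) / (2 * b) * ((a\<^sup>2 + b\<^sup>2) * Y * (1 - Re \<mu>) - 2 * b\<^sup>2 * X * Im \<mu>)"
definition incenter_power :: real where
  "incenter_power = h * (16 * a\<^sup>2 * b\<^sup>2 + 2 * (a\<^sup>2 - b\<^sup>2)\<^sup>2 * (1 - Re \<mu>))"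

lemma \<mu>_circle: "(Re \<mu>)\<^sup>2 + (Im \<mu>)\<^sup>2 = 1"
  using \<mu> by (simp add: cmod_power2[symmetric])

text \<open>Euler's formula in disguise, with \<open>R - 2 r = sqrt h * (a\<^sup>2 -
  b\<^sup>2)\<^sup>2 * (1 - Re \<mu>) / (2 * a * b)\<close>. The common factor
  \<open>incenter_power\<close> leaves a simple ratio of the incenter power to the squared
  distance.\<close>

lemma d_square:
  "8 * a\<^sup>2 * b\<^sup>2 * (dx\<^sup>2 + dy\<^sup>2) = incenter_power * (a\<^sup>2 - b\<^sup>2)\<^sup>2 * (1 - Re \<mu>)"
proof -
  have "2 * a * dx = - (a\<^sup>2 - b\<^sup>2) * ((a\<^sup>2 + b\<^sup>2) * X * (1 - Re \<mu>) + 2 * a\<^sup>2 * Y * Im \<mu>)"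
    "2 * b * dy = - (a\<^sup>2 - b\<^sup>2) * ((a\<^sup>2 + b\<^sup>2) * Y * (1 - Re \<mu>) - 2 * b\<^sup>2 * X * Im \<mu>)"
    using a_pos b_pos by (simp_all add: dx_def dy_def)
  then show ?thesis unfolding incenter_power_def h_def using \<mu>_circle by algebra
qed

lemma circumcenter_PQR:
  shows "circumcenter P Q R = center + (dx, dy)"
    and "(circumradius P Q R)\<^sup>2 = incenter_power + dx\<^sup>2 + dy\<^sup>2"
    and "dist (circumcenter P Q R) P = dist (circumcenter P Q R) Q"
    and "dist (circumcenter P Q R) Q = dist (circumcenter P Q R) R"
proof -
  define s1 s2 s3 where "s1 = u + v + w" and "s2 = u * v + v * w + w * u" and "s3 = u * v * w"
  define zx zy where "zx = (a\<^sup>2 - b\<^sup>2) / (4 * a) * Re (s1 + s3)"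
    and "zy = - (a\<^sup>2 - b\<^sup>2) / (4 * b) * Im (s1 - s3)"
  define \<rho> where "\<rho> = zx\<^sup>2 + zy\<^sup>2 - ((a\<^sup>2 - b\<^sup>2) / 2 * Re s2 - (a\<^sup>2 + b\<^sup>2) / 2)"
  have rot: "v + w + u = s1" "w + u + v = s1" "v * w + w * u + u * v = s2" "w * u + u * v + v * w = s2"
      "v * w * u = s3" "w * u * v = s3"
    by (simp_all add: s1_def s2_def s3_def algebra_simps)
  have ab: "a \<noteq> 0" "b \<noteq> 0" using a_pos b_pos by simp_all
  have d: "(dist (zx, zy) P)\<^sup>2 = \<rho>" "(dist (zx, zy) Q)\<^sup>2 = \<rho>" "(dist (zx, zy) R)\<^sup>2 = \<rho>"
    \<comment> \<open>Rotating the vertices preserves their symmetric functions, hence the point and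
      the distance.\<close>
    using dist_circumcenter_ellipse[OF ab n, folded s1_def s2_def s3_def]
      dist_circumcenter_ellipse[OF ab n(2,3,1), unfolded rot]
      dist_circumcenter_ellipse[OF ab n(3,1,2), unfolded rot]
    unfolding PQR zx_def zy_def \<rho>_def by simp_all
  have eq: "dist (zx, zy) P = dist (zx, zy) Q" "dist (zx, zy) Q = dist (zx, zy) R"
    using d by (metis power2_eq_imp_eq zero_le_dist)+
  have "circumcenter P Q R = (zx, zy)"
    by (rule circumcenter_eqI[OF noncollinear_PQR eq])
  with eq show "dist (circumcenter P Q R) P = dist (circumcenter P Q R) Q"
    "dist (circumcenter P Q R) Q = dist (circumcenter P Q R) R" by simp_all
  have s: "s1 = z * (2 + \<mu>)" "s2 = cnj z * \<omega> * (1 + 2 * \<mu>)" "s3 = \<omega> * \<mu>"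
    using vieta by (simp_all add: vieta_def s1_def s2_def s3_def)
  have zx: "zx = a * ((a\<^sup>2 - b\<^sup>2) * X) + dx"
    unfolding zx_def dx_def s z_def \<omega>_def using ab by (simp add: field_simps power2_eq_square)
  have zy: "zy = b * ((a\<^sup>2 - b\<^sup>2) * Y) + dy"
    unfolding zy_def dy_def s z_def \<omega>_def using ab by (simp add: field_simps power2_eq_square)
  show center: "circumcenter P Q R = center + (dx, dy)"
    unfolding \<open>circumcenter P Q R = (zx, zy)\<close> zx zy center_eq by simp
  have "(circumradius P Q R)\<^sup>2 = \<rho>"
    unfolding circumradius_def \<open>circumcenter P Q R = (zx, zy)\<close> by (rule d)
  also have "\<rho> = incenter_power + dx\<^sup>2 + dy\<^sup>2"
  proof -
    have "Re s2 = (a\<^sup>2 - b\<^sup>2) * ((a\<^sup>2 + 3 * b\<^sup>2) * X\<^sup>2 + (3 * a\<^sup>2 + b\<^sup>2) * Y\<^sup>2) * (1 + 2 * Re \<mu>)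
        - 4 * (a\<^sup>2 - b\<^sup>2)\<^sup>2 * X * Y * Im \<mu>"
      unfolding s z_def \<omega>_def by (simp add: power2_eq_square algebra_simps)
    moreover have "2 * a * dx = - (a\<^sup>2 - b\<^sup>2) * ((a\<^sup>2 + b\<^sup>2) * X * (1 - Re \<mu>) + 2 * a\<^sup>2 * Y * Im \<mu>)"
      "2 * b * dy = - (a\<^sup>2 - b\<^sup>2) * ((a\<^sup>2 + b\<^sup>2) * Y * (1 - Re \<mu>) - 2 * b\<^sup>2 * X * Im \<mu>)"
      using a_pos b_pos by (simp_all add: dx_def dy_def)
    ultimately have "2 * (zx\<^sup>2 + zy\<^sup>2) - ((a\<^sup>2 - b\<^sup>2) * Re s2 - (a\<^sup>2 + b\<^sup>2)) = 2 * (incenter_power + dx\<^sup>2 + dy\<^sup>2)"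
      unfolding zx zy incenter_power_def h_def using on_ellipse by algebra
    then show ?thesis unfolding \<rho>_def by (simp add: field_simps)
  qed
  finally show "(circumradius P Q R)\<^sup>2 = incenter_power + dx\<^sup>2 + dy\<^sup>2" .
qed

text \<open>In an equilateral triangle the incenter is the centroid, whose scaled position is
  \<open>z * (2 + \<mu>) / 3\<close>. Conversely, at \<open>\<mu> = 1\<close> both circumcenter and
  centroid fall on the center.\<close>

lemma equilateral_PQR_iff: "equilateral P Q R \<longleftrightarrow> \<mu> = 1"
proof
  assume "equilateral P Q R"
  define d where "d = dist P Q"
  have d: "dist P Q = d" "dist Q R = d" "dist R P = d"
    using \<open>equilateral P Q R\<close> by (auto simp: d_def equilateral_def)
  have "d \<noteq> 0" using ne ellipse_point_eq_iff[OF a_pos b_pos] by (simp add: d_def PQR)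
  have "incenter P Q R = (1 / 3) *\<^sub>R (P + Q + R)"
    unfolding incenter_def d using \<open>d \<noteq> 0\<close> by (simp flip: scaleR_add_right)
  also have "\<dots> = ellipse_point a b ((u + v + w) / 3)"
    by (simp add: PQR ellipse_point_def algebra_simps add_divide_distrib)
  finally have "ellipse_point a b ((u + v + w) / 3) = ellipse_point a b z"
    using incenter_eq_center[OF in_family] by (simp add: center_def)
  then have "z * (2 + \<mu>) = 3 * z"
    using vieta ellipse_point_eq_iff[OF a_pos b_pos] by (simp add: vieta_def field_simps)
  then have "2 + \<mu> = 3" using z_nonzero by (simp add: mult.commute)
  then show "\<mu> = 1" by (simp add: algebra_simps)
next
  assume "\<mu> = 1"
  then have "dx = 0" "dy = 0" unfolding dx_def dy_def by simp_all
  then have C: "circumcenter P Q R = center"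
    using circumcenter_PQR(1) by (simp add: zero_prod_def[symmetric])
  have "u + v + w = 3 * z" using vieta \<open>\<mu> = 1\<close> by (simp add: vieta_def)
  then have "P + Q + R = ellipse_point a b (3 * z)"
    unfolding PQR by (simp add: ellipse_point_def flip: distrib_left plus_complex.sel)
  also have "\<dots> = 3 *\<^sub>R center" by (simp add: center_def ellipse_point_def)
  finally show "equilateral P Q R"
    using equilateral_if_centroid_eq_circumcenter circumcenter_PQR(3,4) C by metis
qed

lemma X36_PQR:
  assumes "\<mu> \<noteq> 1"
  shows "X36 P Q R = X36_at (Im \<mu> / (1 - Re \<mu>))"
proof -
  have "Re \<mu> \<noteq> 1" using \<mu>_circle assms by (auto simp: complex_eq_iff)
  moreover have "Re \<mu> \<le> 1" using complex_Re_le_cmod[of \<mu>] \<mu> by simp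
  ultimately have m: "0 < 1 - Re \<mu>" by simp
  define t where "t = Im \<mu> / (1 - Re \<mu>)"
  have t: "Im \<mu> = t * (1 - Re \<mu>)" using m by (simp add: t_def)
  have e: "a\<^sup>2 - b\<^sup>2 \<noteq> 0" and ab: "a \<noteq> 0" "b \<noteq> 0" using diff_pos a_pos b_pos by auto
  have "0 < incenter_power" using h_pos a_pos b_pos m by (simp add: incenter_power_def add_pos_nonneg)
  have D: "0 < dx\<^sup>2 + dy\<^sup>2"
  proof -
    have "0 < incenter_power * (a\<^sup>2 - b\<^sup>2)\<^sup>2 * (1 - Re \<mu>)" using \<open>0 < incenter_power\<close> e m by simp
    then show ?thesis unfolding d_square[symmetric]
      by (rule zero_less_mult_pos) (use a_pos b_pos in simp)
  qed
  have ratio: "incenter_power / (dx\<^sup>2 + dy\<^sup>2) = 8 * a\<^sup>2 * b\<^sup>2 / ((a\<^sup>2 - b\<^sup>2)\<^sup>2 * (1 - Re \<mu>))"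
  proof -
    have "dx\<^sup>2 + dy\<^sup>2 \<noteq> 0" "(a\<^sup>2 - b\<^sup>2)\<^sup>2 * (1 - Re \<mu>) \<noteq> 0" using D m e by auto
    then show ?thesis using d_square unfolding mult.assoc by (subst frac_eq_eq) (simp_all only: mult.assoc simp_thms)
  qed
  have d2: "(dist (center + (dx, dy)) center)\<^sup>2 = dx\<^sup>2 + dy\<^sup>2"
    by (simp add: dist_norm norm_Pair)
  have "X36 P Q R = center + (dx, dy) - ((incenter_power + dx\<^sup>2 + dy\<^sup>2) / (dx\<^sup>2 + dy\<^sup>2)) *\<^sub>R (dx, dy)"
    unfolding X36_def circle_inverse_def incenter_eq_center[OF in_family] circumcenter_PQR d2
    by simp
  also have "(incenter_power + dx\<^sup>2 + dy\<^sup>2) / (dx\<^sup>2 + dy\<^sup>2) = 1 + incenter_power / (dx\<^sup>2 + dy\<^sup>2)"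
  proof -
    have "(p + x + y) / (x + y) = 1 + p / (x + y)" if "0 < x + y" for p x y :: real
      using that by (simp add: field_simps)
    then show ?thesis using D .
  qed
  also have "center + (dx, dy) - (1 + incenter_power / (dx\<^sup>2 + dy\<^sup>2)) *\<^sub>R (dx, dy) =
      center - (8 * a\<^sup>2 * b\<^sup>2 / ((a\<^sup>2 - b\<^sup>2)\<^sup>2 * (1 - Re \<mu>))) *\<^sub>R (dx, dy)"
    unfolding ratio by (simp add: algebra_simps)
  also have "(8 * a\<^sup>2 * b\<^sup>2 / ((a\<^sup>2 - b\<^sup>2)\<^sup>2 * (1 - Re \<mu>))) *\<^sub>R (dx, dy) =
      - ((4 * a * b / (a\<^sup>2 - b\<^sup>2)) *\<^sub>R
     (b * ((a\<^sup>2 + b\<^sup>2) * X + 2 * a\<^sup>2 * Y * t), a * ((a\<^sup>2 + b\<^sup>2) * Y - 2 * b\<^sup>2 * X * t)))"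
  proof -
    \<comment> \<open>Both \<open>dx\<close> and \<open>dy\<close> are \<open>1 - Re \<mu>\<close>
      times an affine function of \<open>t\<close>, and that factor cancels against the denominator
      of \<open>ratio\<close>.\<close>
    have cancel: "8 * a\<^sup>2 * b\<^sup>2 / (E\<^sup>2 * s) * (- E / (2 * c) * (p * s)) = - (4 * a * b / E * (a * b / c * p))"
      if "E \<noteq> 0" "s \<noteq> 0" "c \<noteq> 0" for E s c p :: real
      using that by (simp add: field_simps power2_eq_square)
    have "dx = - (a\<^sup>2 - b\<^sup>2) / (2 * a) * (((a\<^sup>2 + b\<^sup>2) * X + 2 * a\<^sup>2 * Y * t) * (1 - Re \<mu>))"
      "dy = - (a\<^sup>2 - b\<^sup>2) / (2 * b) * (((a\<^sup>2 + b\<^sup>2) * Y - 2 * b\<^sup>2 * X * t) * (1 - Re \<mu>))"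
      unfolding dx_def dy_def t by (simp_all only: distrib_right left_diff_distrib mult.assoc)
    then have "8 * a\<^sup>2 * b\<^sup>2 / ((a\<^sup>2 - b\<^sup>2)\<^sup>2 * (1 - Re \<mu>)) * dx =
        - (4 * a * b / (a\<^sup>2 - b\<^sup>2) * (a * b / a * ((a\<^sup>2 + b\<^sup>2) * X + 2 * a\<^sup>2 * Y * t)))"
      "8 * a\<^sup>2 * b\<^sup>2 / ((a\<^sup>2 - b\<^sup>2)\<^sup>2 * (1 - Re \<mu>)) * dy =
        - (4 * a * b / (a\<^sup>2 - b\<^sup>2) * (a * b / b * ((a\<^sup>2 + b\<^sup>2) * Y - 2 * b\<^sup>2 * X * t)))"
      using cancel[OF e _ ab(1)] cancel[OF e _ ab(2)] m by (metis less_irrefl)+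
    then show ?thesis using ab by (simp only: scaleR_Pair real_scaleR_def uminus_Pair) simp
  qed
  finally show ?thesis by (simp add: X36_at_def t_def)
qed

end

section \<open>The locus as a line\<close>

lemma locus_X36_eq_range: "locus_X36 a b center = range X36_at"
proof
  show "locus_X36 a b center \<subseteq> range X36_at"
  proof
    fix p assume "p \<in> locus_X36 a b center"
    then obtain P Q R where p: "p = X36 P Q R" "(P, Q, R) \<in> poncelet_family a b center"
      "\<not> equilateral P Q R"
      unfolding locus_X36_def by blast
    then obtain \<mu> u v w where member: "norm \<mu> = 1" "vieta \<mu> u v w" "norm u = 1" "norm v = 1" "norm w = 1"
      "u \<noteq> v" "v \<noteq> w" "w \<noteq> u" "P = ellipse_point a b u" "Q = ellipse_point a b v" "R = ellipse_point a b w"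
      unfolding poncelet_family_iff by blast
    have "\<mu> \<noteq> 1" using equilateral_PQR_iff[OF member] p(3) by blast
    then show "p \<in> range X36_at" using X36_PQR[OF member] p(1) by blast
  qed
  show "range X36_at \<subseteq> locus_X36 a b center"
  proof
    fix p assume "p \<in> range X36_at"
    then obtain t where t: "p = X36_at t" by blast
    \<comment> \<open>Every real \<open>t\<close> comes from a parameter other than 1, that is, from
      a non-equilateral triangle.\<close>
    obtain \<mu> :: complex where \<mu>: "norm \<mu> = 1" "\<mu> \<noteq> 1" "Im \<mu> / (1 - Re \<mu>) = t"
      using Im_over_one_minus_Re_onto .
    obtain u v w where "vieta \<mu> u v w" "norm u = 1" "norm v = 1" "norm w = 1" "u \<noteq> v" "v \<noteq> w" "w \<noteq> u"
      using vieta_triangle_exists[OF \<mu>(1)] .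
    note member = \<mu>(1) this refl refl refl
    have "p = X36 (ellipse_point a b u) (ellipse_point a b v) (ellipse_point a b w)"
      using X36_PQR[OF member] \<mu> t by simp
    then show "p \<in> locus_X36 a b center"
      unfolding locus_X36_def
      using in_family[OF member] equilateral_PQR_iff[OF member] \<mu>(2) by blast
  qed
qed

lemma range_X36_at:
  "range X36_at = {(x, y). b\<^sup>2 * (a * (a\<^sup>2 - b\<^sup>2) * X) * x + a\<^sup>2 * (b * (a\<^sup>2 - b\<^sup>2) * Y) * y =
     a\<^sup>2 * b\<^sup>2 * ((a^4 + 2 * a\<^sup>2 * b\<^sup>2 + 5 * b^4) * X\<^sup>2 + (5 * a^4 + 2 * a\<^sup>2 * b\<^sup>2 + b^4) * Y\<^sup>2)}"
    (is "_ = {(x, y). ?line x y}")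
proof (intro subset_antisym subsetI)
  define E where "E = a\<^sup>2 - b\<^sup>2"
  have nz: "E \<noteq> 0" "a \<noteq> 0" "b \<noteq> 0" using diff_pos a_pos b_pos by (auto simp: E_def)
  have at: "X36_at t = (x, y) \<longleftrightarrow>
      E * x = E * (a * (E * X)) + 4 * a * b * (b * ((a\<^sup>2 + b\<^sup>2) * X + 2 * a\<^sup>2 * Y * t)) \<and>
      E * y = E * (b * (E * Y)) + 4 * a * b * (a * ((a\<^sup>2 + b\<^sup>2) * Y - 2 * b\<^sup>2 * X * t))" for t x y
  proof -
    have "p + 4 * a * b / E * s = x' \<longleftrightarrow> E * x' = E * p + 4 * a * b * s" for p s x'
      using nz by (auto simp: field_simps)
    then show ?thesis unfolding X36_at_def center_eq E_def[symmetric]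
      by (simp only: add_Pair scaleR_Pair real_scaleR_def prod.inject)
  qed
  {
    fix p assume "p \<in> range X36_at"
    then obtain t x y where p: "X36_at t = (x, y)" "p = (x, y)" by (metis rangeE surj_pair)
    note eqs = p(1)[unfolded at]
    have "?line x y" using conjunct1[OF eqs] conjunct2[OF eqs] unfolding E_def by algebra
    then show "p \<in> {(x, y). ?line x y}" using p by simp
  next
    fix p assume "p \<in> {(x, y). ?line x y}"
    then obtain x y where p: "p = (x, y)" "?line x y" by blast
    \<comment> \<open>\<open>(f, g)\<close> is \<open>E\<close> times the offset of
      \<open>(x, y)\<close> from \<open>X36_at 0\<close>; the line equation makes it orthogonal to
      \<open>(b * X, a * Y)\<close>.\<close>
    define f where "f = E * x - a * E\<^sup>2 * X - 4 * a * b\<^sup>2 * (a\<^sup>2 + b\<^sup>2) * X"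
    define g where "g = E * y - b * E\<^sup>2 * Y - 4 * a\<^sup>2 * b * (a\<^sup>2 + b\<^sup>2) * Y"
    have "a * b * (b * X * f + a * Y * g) = 0"
      using p(2) unfolding f_def g_def E_def by algebra
    then have perp: "b * X * f + a * Y * g = 0" using nz by simp
    \<comment> \<open>Projection of \<open>(f, g)\<close> on the direction
      \<open>(a * Y, - b * X)\<close>, whose squared length is \<open>h\<close>.\<close>
    define t where "t = (a * Y * f - b * X * g) / (8 * a\<^sup>2 * b\<^sup>2 * h)"
    have t: "8 * a\<^sup>2 * b\<^sup>2 * h * t = a * Y * f - b * X * g"
      using nz h_pos by (simp add: t_def)
    have "h * f = h * (8 * a^3 * b\<^sup>2 * Y * t)" "h * g = h * (- 8 * a\<^sup>2 * b^3 * X * t)"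
      using t perp unfolding h_def by algebra+
    then have "f = 8 * a^3 * b\<^sup>2 * Y * t" "g = - 8 * a\<^sup>2 * b^3 * X * t"
      using h_pos by (metis mult_left_cancel less_irrefl)+
    then have "X36_at t = (x, y)"
      unfolding at f_def g_def by algebra
    then show "p \<in> range X36_at" using p(1) by (metis rangeI)
  }
qed

end

theorem proposition17:
  fixes a b c x\<^sub>c y\<^sub>c :: real
  assumes "a > b" and "b > 0" and "c\<^sup>2 = a\<^sup>2 - b\<^sup>2"
    and "(x\<^sub>c, y\<^sub>c) \<in> ellipse (a * c\<^sup>2 / (a\<^sup>2 + 3 * b\<^sup>2)) (b * c\<^sup>2 / (3 * a\<^sup>2 + b\<^sup>2))"
  shows "locus_X36 a b (x\<^sub>c, y\<^sub>c) =
    {(x, y). b\<^sup>2 * x\<^sub>c * x + a\<^sup>2 * y\<^sub>c * y =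
       (b\<^sup>2 * (a^4 + 2 * a\<^sup>2 * b\<^sup>2 + 5 * b^4) * x\<^sub>c\<^sup>2
         + a\<^sup>2 * (5 * a^4 + 2 * a\<^sup>2 * b\<^sup>2 + b^4) * y\<^sub>c\<^sup>2) / c^4}"
proof -
  \<comment> \<open>This scaling turns the semi-axes of the ellipse of the center into
    \<open>1 / (a\<^sup>2 + 3 * b\<^sup>2)\<close> and
    \<open>1 / (3 * a\<^sup>2 + b\<^sup>2)\<close>.\<close>
  define X Y where "X = x\<^sub>c / (a * c\<^sup>2)" and "Y = y\<^sub>c / (b * c\<^sup>2)"
  have c2: "0 < c\<^sup>2" using assms(1-3) by (simp add: power_strict_mono)
  have nz: "a \<noteq> 0" "b \<noteq> 0" "c \<noteq> 0" using c2 assms(1,2) by auto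
  have C: "x\<^sub>c = a * c\<^sup>2 * X" "y\<^sub>c = b * c\<^sup>2 * Y" using nz by (simp_all add: X_def Y_def)
  have "((a\<^sup>2 + 3 * b\<^sup>2) * X)\<^sup>2 + ((3 * a\<^sup>2 + b\<^sup>2) * Y)\<^sup>2 = 1"
    using assms(4) by (simp add: ellipse_def X_def Y_def power_divide power_mult_distrib mult.commute)
  then interpret equilateral_center a b X Y
    using assms(1,2) by unfold_locales
  have center: "center = (x\<^sub>c, y\<^sub>c)" unfolding center_eq C assms(3) by (simp add: mult.assoc)
  have "(b\<^sup>2 * (a^4 + 2 * a\<^sup>2 * b\<^sup>2 + 5 * b^4) * x\<^sub>c\<^sup>2 + a\<^sup>2 * (5 * a^4 + 2 * a\<^sup>2 * b\<^sup>2 + b^4) * y\<^sub>c\<^sup>2) =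
      c^4 * (a\<^sup>2 * b\<^sup>2 * ((a^4 + 2 * a\<^sup>2 * b\<^sup>2 + 5 * b^4) * X\<^sup>2 + (5 * a^4 + 2 * a\<^sup>2 * b\<^sup>2 + b^4) * Y\<^sup>2))"
    unfolding C by algebra
  then have "(b\<^sup>2 * (a^4 + 2 * a\<^sup>2 * b\<^sup>2 + 5 * b^4) * x\<^sub>c\<^sup>2 + a\<^sup>2 * (5 * a^4 + 2 * a\<^sup>2 * b\<^sup>2 + b^4) * y\<^sub>c\<^sup>2) / c^4 =
      a\<^sup>2 * b\<^sup>2 * ((a^4 + 2 * a\<^sup>2 * b\<^sup>2 + 5 * b^4) * X\<^sup>2 + (5 * a^4 + 2 * a\<^sup>2 * b\<^sup>2 + b^4) * Y\<^sup>2)"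
    using nz by simp
  then show ?thesis
    using locus_X36_eq_range unfolding center range_X36_at assms(3)[symmetric] C by simp
qed

end
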